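(* Let $V$ be a nontrivial finite-dimensional irreducible $\boxtimes$-module over $\mathbb F$, and write $V$ as a tensor product of evaluation modules: $$V=V_{d_1}(a_1)\otimes V_{d_2}(a_2)\otimes\cdots\otimes V_{d_N}(a_N).$$ Then the shape $\{\rho_n\}_{n=0}^d$ of $V$ satisfies $$\sum_{n=0}^d\rho_n\lambda^n=\prod_{j=1}^N(1+\lambda+\lambda^2+\cdots+\lambda^{d_j}),$$ where $\lambda$ is an indeterminate. In particular $\rho_0=1$.
   Context: $\mathbb F$ is an algebraically closed field of characteristic $0$, and $\mathbb I=\{0,1,2,3\}$. The tetrahedron algebra $\boxtimes$ is the Lie algebra over $\mathbb F$ with generators $\{x_{ij}\mid i,j\in\mathbb I,\ i\ne j\}$ and relations: (i) $x_{ij}+x_{ji}=0$ for distinct $i,j$; (ii) $[x_{ij},x_{jk}]=2x_{ij}+2x_{jk}$ for mutually distinct $i,j,k$; (iii) $[x_{ij},[x_{ij},[x_{ij},x_{k\ell}]]]=4[x_{ij},x_{k\ell}]$ for mutually distinct $i,j,k,\ell$. The trivial $\boxtimes$-module is the one-dimensional module on which $\boxtimes$ acts as $0$. Tensor products of $\boxtimes$-modules carry the usual action $\xi.(u\otimes v)=(\xi.u)\otimes v+u\otimes(\xi.v)$. Shape: for a finite-dimensional irreducible $\boxtimes$-module $V$ it is known (Hartwig) that every $x_{ij}$ acts semisimply on $V$ and that there is an integer $d\ge0$ (the diameter of $V$) such that for all distinct $i,j$ the set of distinct eigenvalues of $x_{ij}$ on $V$ is $\{d-2n\mid 0\le n\le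 d\}$; moreover for $0\le n\le d$ the dimension $\rho_n$ of the eigenspace of $x_{ij}$ for eigenvalue $2n-d$ does not depend on $i,j$. The shape of $V$ is the sequence $\{\rho_n\}_{n=0}^d$. Evaluation modules: let $\mathfrak{sl}_2=\mathfrak{sl}_2(\mathbb F)$ with basis $e,f,h$, $[h,e]=2e$, $[h,f]=-2f$, $[e,f]=h$. Put $x=2e-h$, $y=-2f-h$, $z=h$. For $a\in\mathbb F\setminus\{0,1\}$ let $EV_a:\boxtimes\to\mathfrak{sl}_2$ be the (surjective) Lie algebra homomorphism with $x_{12}\mapsto x$, $x_{23}\mapsto y$, $x_{31}\mapsto z$, $x_{03}\mapsto ay+(a-1)z$, $x_{01}\mapsto(1-a^{-1})z-a^{-1}x$, $x_{02}\mapsto(1-a)^{-1}x+a(1-a)^{-1}y$. For $d\ge0$ let $V_d$ be the irreducible $\mathfrak{sl}_2$-module of dimension $d+1$. An evaluation module is a $\boxtimes$-module $V_d(a)$, with $d\ge 1$ an integer and $a\in\mathbb F\setminus\{0,1\}$, obtained from $V_d$ by pulling back the action via $EV_a$. *)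

theory Defs
  imports "HOL-Analysis.Determinants" "HOL-Library.Poly_Mapping"
    "HOL-Computational_Algebra.Polynomial"
begin

section \<open>Lie algebras and their modules\<close>

locale lie_algebra = vector_space lscale
  for lscale :: "'a::field \<Rightarrow> 'l::ab_group_add \<Rightarrow> 'l" +
  fixes bracket :: "'l \<Rightarrow> 'l \<Rightarrow> 'l"
  assumes bracket_add_left: "bracket (x + y) z = bracket x z + bracket y z"
    and bracket_add_right: "bracket x (y + z) = bracket x y + bracket x z"
    and bracket_scale_left: "bracket (lscale c x) y = lscale c (bracket x y)"
    and bracket_scale_right: "bracket x (lscale c y) = lscale c (bracket x y)"
    and bracket_self: "bracket x x = 0"
    and jacobi: "bracket x (bracket y z) + bracket y (bracket z x) + bracket z (bracket x y) = 0"

definition lie_hom ::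
  "('a::field \<Rightarrow> 'l::ab_group_add \<Rightarrow> 'l) \<Rightarrow> ('l \<Rightarrow> 'l \<Rightarrow> 'l) \<Rightarrow>
   ('a \<Rightarrow> 'm::ab_group_add \<Rightarrow> 'm) \<Rightarrow> ('m \<Rightarrow> 'm \<Rightarrow> 'm) \<Rightarrow> ('l \<Rightarrow> 'm) \<Rightarrow> bool" where
  "lie_hom lscale bracket lscale' bracket' \<phi> \<longleftrightarrow>
     Vector_Spaces.linear lscale lscale' \<phi> \<and>
     (\<forall>x y. \<phi> (bracket x y) = bracket' (\<phi> x) (\<phi> y))"

text \<open>The underlying vector space of a module is a subspace \<open>V\<close> of an arbitrary ambient
  space; the value of \<open>act \<xi>\<close> outside \<open>V\<close> is irrelevant.\<close>

locale lie_module = lie_algebra lscale bracket + M: vector_space smul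
  for lscale :: "'a::field \<Rightarrow> 'l::ab_group_add \<Rightarrow> 'l"
    and bracket :: "'l \<Rightarrow> 'l \<Rightarrow> 'l"
    and smul :: "'a \<Rightarrow> 'v::ab_group_add \<Rightarrow> 'v" +
  fixes V :: "'v set" and act :: "'l \<Rightarrow> 'v \<Rightarrow> 'v"
  assumes carrier_subspace: "M.subspace V"
    and act_closed: "v \<in> V \<Longrightarrow> act \<xi> v \<in> V"
    and act_add_right: "v \<in> V \<Longrightarrow> w \<in> V \<Longrightarrow> act \<xi> (v + w) = act \<xi> v + act \<xi> w"
    and act_scale_right: "v \<in> V \<Longrightarrow> act \<xi> (smul c v) = smul c (act \<xi> v)"
    and act_add_left: "v \<in> V \<Longrightarrow> act (\<xi> + \<eta>) v = act \<xi> v + act \<eta> v"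
    and act_scale_left: "v \<in> V \<Longrightarrow> act (lscale c \<xi>) v = smul c (act \<xi> v)"
    and act_bracket: "v \<in> V \<Longrightarrow> act (bracket \<xi> \<eta>) v = act \<xi> (act \<eta> v) - act \<eta> (act \<xi> v)"

definition finite_dim_space :: "('a::field \<Rightarrow> 'v::ab_group_add \<Rightarrow> 'v) \<Rightarrow> 'v set \<Rightarrow> bool" where
  "finite_dim_space smul V \<longleftrightarrow> (\<exists>B. finite B \<and> B \<subseteq> V \<and> module.span smul B = V)"

definition irreducible_module ::
  "('a::field \<Rightarrow> 'v::ab_group_add \<Rightarrow> 'v) \<Rightarrow> 'v set \<Rightarrow> ('l \<Rightarrow> 'v \<Rightarrow> 'v) \<Rightarrow> bool" where
  "irreducible_module smul V act \<longleftrightarrow> V \<noteq> {0} \<and>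
     (\<forall>W. module.subspace smul W \<and> W \<subseteq> V \<and> (\<forall>\<xi>. \<forall>w\<in>W. act \<xi> w \<in> W) \<longrightarrow> W = {0} \<or> W = V)"

definition trivial_module ::
  "('a::field \<Rightarrow> 'v::ab_group_add \<Rightarrow> 'v) \<Rightarrow> 'v set \<Rightarrow> ('l \<Rightarrow> 'v \<Rightarrow> 'v) \<Rightarrow> bool" where
  "trivial_module smul V act \<longleftrightarrow>
     vector_space.dim smul V = 1 \<and> (\<forall>\<xi>. \<forall>v\<in>V. act \<xi> v = 0)"

definition eigenspace ::
  "('a::field \<Rightarrow> 'v::ab_group_add \<Rightarrow> 'v) \<Rightarrow> 'v set \<Rightarrow> ('v \<Rightarrow> 'v) \<Rightarrow> 'a \<Rightarrow> 'v set" where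
  "eigenspace smul V T c = {v \<in> V. T v = smul c v}"

definition eigenvalues ::
  "('a::field \<Rightarrow> 'v::ab_group_add \<Rightarrow> 'v) \<Rightarrow> 'v set \<Rightarrow> ('v \<Rightarrow> 'v) \<Rightarrow> 'a set" where
  "eigenvalues smul V T = {c. \<exists>v\<in>V. v \<noteq> 0 \<and> T v = smul c v}"


section \<open>Tensor products of finitely many modules\<close>

text \<open>The vector space with basis \<open>'b\<close> is \<open>'b \<Rightarrow>\<^sub>0 'a\<close>.\<close>

definition free_scale :: "'a::field \<Rightarrow> ('b \<Rightarrow>\<^sub>0 'a) \<Rightarrow> ('b \<Rightarrow>\<^sub>0 'a)" where
  "free_scale c p = Poly_Mapping.map ((*) c) p"

lemma lookup_free_scale: "Poly_Mapping.lookup (free_scale c p) x = c * Poly_Mapping.lookup p x"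
  unfolding free_scale_def by transfer (auto simp: when_def)

lemma vector_space_free_scale:
  "vector_space (free_scale :: 'a::field \<Rightarrow> ('b \<Rightarrow>\<^sub>0 'a) \<Rightarrow> ('b \<Rightarrow>\<^sub>0 'a))"
  by unfold_locales
     (auto intro!: poly_mapping_eqI simp: lookup_free_scale lookup_add algebra_simps)

text \<open>Families \<open>u\<close> with \<open>u j \<in> U j\<close> are elements of \<open>PiE I U\<close>.  The tensor product of the
  \<open>U j\<close> is the quotient of the free vector space on \<open>PiE I U\<close> by the span of the following
  multilinearity relations.\<close>

definition tensor_rels ::
  "('a::field \<Rightarrow> 'u::ab_group_add \<Rightarrow> 'u) \<Rightarrow> 'i set \<Rightarrow> ('i \<Rightarrow> 'u set) \<Rightarrow> (('i \<Rightarrow> 'u) \<Rightarrow>\<^sub>0 'a) set" where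
  "tensor_rels smulU I U =
     {Poly_Mapping.single (u(j := w + w')) 1 - Poly_Mapping.single (u(j := w)) 1
        - Poly_Mapping.single (u(j := w')) 1 | u j w w'.
        u \<in> PiE I U \<and> j \<in> I \<and> w \<in> U j \<and> w' \<in> U j} \<union>
     {Poly_Mapping.single (u(j := smulU c w)) 1
        - free_scale c (Poly_Mapping.single (u(j := w)) 1) | u j w c.
        u \<in> PiE I U \<and> j \<in> I \<and> w \<in> U j}"

definition free_extend ::
  "('a::field \<Rightarrow> 'v::ab_group_add \<Rightarrow> 'v) \<Rightarrow> ('b \<Rightarrow> 'v) \<Rightarrow> ('b \<Rightarrow>\<^sub>0 'a) \<Rightarrow> 'v" where
  "free_extend smul \<tau> p =
     (\<Sum>b\<in>Poly_Mapping.keys p. smul (Poly_Mapping.lookup p b) (\<tau> b))"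

text \<open>\<open>V\<close> together with \<open>\<tau>\<close>, where \<open>\<tau> u\<close> stands for the pure tensor of the family \<open>u\<close>, is a
  tensor product of the \<open>U j\<close>: the linear extension of \<open>\<tau>\<close> to the free vector space maps onto
  \<open>V\<close> and its kernel is exactly the span of the relations, so it induces an isomorphism of
  the quotient with \<open>V\<close>.\<close>

definition is_tensor_product ::
  "('a::field \<Rightarrow> 'u::ab_group_add \<Rightarrow> 'u) \<Rightarrow> 'i set \<Rightarrow> ('i \<Rightarrow> 'u set) \<Rightarrow>
   ('a \<Rightarrow> 'v::ab_group_add \<Rightarrow> 'v) \<Rightarrow> 'v set \<Rightarrow> (('i \<Rightarrow> 'u) \<Rightarrow> 'v) \<Rightarrow> bool" where
  "is_tensor_product smulU I U smul V \<tau> \<longleftrightarrow>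
     free_extend smul \<tau> ` {p. Poly_Mapping.keys p \<subseteq> PiE I U} = V \<and>
     {p. Poly_Mapping.keys p \<subseteq> PiE I U \<and> free_extend smul \<tau> p = 0} =
       module.span free_scale (tensor_rels smulU I U)"

definition is_tensor_module ::
  "('a::field \<Rightarrow> 'u::ab_group_add \<Rightarrow> 'u) \<Rightarrow> 'i set \<Rightarrow> ('i \<Rightarrow> 'u set) \<Rightarrow> ('i \<Rightarrow> 'l \<Rightarrow> 'u \<Rightarrow> 'u) \<Rightarrow>
   ('a \<Rightarrow> 'v::ab_group_add \<Rightarrow> 'v) \<Rightarrow> 'v set \<Rightarrow> ('l \<Rightarrow> 'v \<Rightarrow> 'v) \<Rightarrow> bool" where
  "is_tensor_module smulU I U actU smul V act \<longleftrightarrow>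
     (\<exists>\<tau>. is_tensor_product smulU I U smul V \<tau> \<and>
       (\<forall>\<xi>. \<forall>u\<in>PiE I U. act \<xi> (\<tau> u) = (\<Sum>j\<in>I. \<tau> (u(j := actU j \<xi> (u j))))))"


section \<open>The tetrahedron algebra\<close>

datatype idx = I0 | I1 | I2 | I3

typedef edge = "{(i, j). (i :: idx) \<noteq> j}"
  by (rule exI[of _ "(I0, I1)"]) simp

datatype 'a lie_term =
    Gen edge
  | Zero
  | Plus "'a lie_term" "'a lie_term"
  | Scale 'a "'a lie_term"
  | Br "'a lie_term" "'a lie_term"

abbreviation XG :: "idx \<Rightarrow> idx \<Rightarrow> 'a lie_term" where
  "XG i j \<equiv> Gen (Abs_edge (i, j))"

text \<open>The Lie algebra with these generators and relations is the set of formal Lie terms modulo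
  the least congruence containing the Lie algebra axioms and the defining relations.\<close>

inductive tetra_eq :: "'a::field lie_term \<Rightarrow> 'a lie_term \<Rightarrow> bool" where
  refl: "tetra_eq s s"
| sym: "tetra_eq s t \<Longrightarrow> tetra_eq t s"
| trans: "tetra_eq s t \<Longrightarrow> tetra_eq t u \<Longrightarrow> tetra_eq s u"
| Plus_cong: "tetra_eq s s' \<Longrightarrow> tetra_eq t t' \<Longrightarrow> tetra_eq (Plus s t) (Plus s' t')"
| Scale_cong: "tetra_eq s s' \<Longrightarrow> tetra_eq (Scale c s) (Scale c s')"
| Br_cong: "tetra_eq s s' \<Longrightarrow> tetra_eq t t' \<Longrightarrow> tetra_eq (Br s t) (Br s' t')"
| Plus_assoc: "tetra_eq (Plus (Plus s t) u) (Plus s (Plus t u))"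
| Plus_comm: "tetra_eq (Plus s t) (Plus t s)"
| Plus_Zero: "tetra_eq (Plus Zero s) s"
| Plus_inv: "tetra_eq (Plus (Scale (-1) s) s) Zero"
| Scale_Plus: "tetra_eq (Scale c (Plus s t)) (Plus (Scale c s) (Scale c t))"
| Scale_add: "tetra_eq (Scale (c + d) s) (Plus (Scale c s) (Scale d s))"
| Scale_Scale: "tetra_eq (Scale c (Scale d s)) (Scale (c * d) s)"
| Scale_one: "tetra_eq (Scale 1 s) s"
| Br_Plus_left: "tetra_eq (Br (Plus s t) u) (Plus (Br s u) (Br t u))"
| Br_Plus_right: "tetra_eq (Br s (Plus t u)) (Plus (Br s t) (Br s u))"
| Br_Scale_left: "tetra_eq (Br (Scale c s) t) (Scale c (Br s t))"
| Br_Scale_right: "tetra_eq (Br s (Scale c t)) (Scale c (Br s t))"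
| Br_self: "tetra_eq (Br s s) Zero"
| Br_Jacobi: "tetra_eq (Plus (Plus (Br s (Br t u)) (Br t (Br u s))) (Br u (Br s t))) Zero"
| rel_skew: "i \<noteq> j \<Longrightarrow> tetra_eq (Plus (XG i j) (XG j i)) Zero"
| rel_triangle: "distinct [i, j, k] \<Longrightarrow>
    tetra_eq (Br (XG i j) (XG j k)) (Plus (Scale 2 (XG i j)) (Scale 2 (XG j k)))"
| rel_Dolan_Grady: "distinct [i, j, k, l] \<Longrightarrow>
    tetra_eq (Br (XG i j) (Br (XG i j) (Br (XG i j) (XG k l))))
             (Scale 4 (Br (XG i j) (XG k l)))"

quotient_type (overloaded) 'a tetra = "'a::field lie_term" / tetra_eq
  by (rule equivpI)
     (auto intro!: reflpI sympI transpI intro: tetra_eq.refl tetra_eq.sym tetra_eq.trans)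

instantiation tetra :: (field) ab_group_add
begin

lift_definition zero_tetra :: "'a tetra" is Zero .
lift_definition plus_tetra :: "'a tetra \<Rightarrow> 'a tetra \<Rightarrow> 'a tetra" is Plus
  by (rule tetra_eq.Plus_cong)
lift_definition uminus_tetra :: "'a tetra \<Rightarrow> 'a tetra" is "Scale (-1)"
  by (rule tetra_eq.Scale_cong)
lift_definition minus_tetra :: "'a tetra \<Rightarrow> 'a tetra \<Rightarrow> 'a tetra"
  is "\<lambda>s t. Plus s (Scale (-1) t)"
  by (intro tetra_eq.Plus_cong tetra_eq.Scale_cong)

instance
  by standard
     (transfer, auto intro: tetra_eq.intros(1) tetra_eq.Plus_assoc tetra_eq.Plus_comm
        tetra_eq.Plus_Zero tetra_eq.Plus_inv)+

end

lift_definition tetra_scale :: "'a::field \<Rightarrow> 'a tetra \<Rightarrow> 'a tetra" is Scale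
  by (rule tetra_eq.Scale_cong)

lift_definition tetra_bracket :: "'a::field tetra \<Rightarrow> 'a tetra \<Rightarrow> 'a tetra" is Br
  by (rule tetra_eq.Br_cong)

text \<open>Only meaningful for \<open>i \<noteq> j\<close>.\<close>

lift_definition tetra_x :: "idx \<Rightarrow> idx \<Rightarrow> 'a::field tetra" is XG .

lemma lie_algebra_tetra: "lie_algebra tetra_scale tetra_bracket"
  by unfold_locales
     (transfer, intro tetra_eq.Scale_Plus tetra_eq.Scale_add tetra_eq.Scale_Scale
        tetra_eq.Scale_one tetra_eq.Br_Plus_left tetra_eq.Br_Plus_right
        tetra_eq.Br_Scale_left tetra_eq.Br_Scale_right tetra_eq.Br_self tetra_eq.Br_Jacobi)+

lemma tetra_x_skew: "i \<noteq> j \<Longrightarrow> tetra_x i j + tetra_x j i = 0"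
  by transfer (rule tetra_eq.rel_skew)

lemma tetra_x_triangle: "distinct [i, j, k] \<Longrightarrow>
  tetra_bracket (tetra_x i j) (tetra_x j k) = tetra_scale 2 (tetra_x i j) + tetra_scale 2 (tetra_x j k)"
  by transfer (rule tetra_eq.rel_triangle)

lemma tetra_x_Dolan_Grady: "distinct [i, j, k, l] \<Longrightarrow>
  tetra_bracket (tetra_x i j) (tetra_bracket (tetra_x i j) (tetra_bracket (tetra_x i j) (tetra_x k l)))
    = tetra_scale 4 (tetra_bracket (tetra_x i j) (tetra_x k l))"
  by transfer (rule tetra_eq.rel_Dolan_Grady)

primrec lie_eval ::
  "('a \<Rightarrow> 'l \<Rightarrow> 'l) \<Rightarrow> ('l \<Rightarrow> 'l \<Rightarrow> 'l) \<Rightarrow> (idx \<Rightarrow> idx \<Rightarrow> 'l::ab_group_add) \<Rightarrow> 'a lie_term \<Rightarrow> 'l" where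
  "lie_eval sc br g (Gen e) = (case Rep_edge e of (i, j) \<Rightarrow> g i j)"
| "lie_eval sc br g Zero = 0"
| "lie_eval sc br g (Plus s t) = lie_eval sc br g s + lie_eval sc br g t"
| "lie_eval sc br g (Scale c s) = sc c (lie_eval sc br g s)"
| "lie_eval sc br g (Br s t) = br (lie_eval sc br g s) (lie_eval sc br g t)"

lemma lie_eval_XG: "i \<noteq> j \<Longrightarrow> lie_eval sc br g (XG i j) = g i j"
  by (simp add: Abs_edge_inverse)

lemma lie_eval_cong:
  assumes "lie_algebra sc br"
    and skew: "\<And>i j. i \<noteq> j \<Longrightarrow> g i j + g j i = 0"
    and tri: "\<And>i j k. distinct [i, j, k] \<Longrightarrow> br (g i j) (g j k) = sc 2 (g i j) + sc 2 (g j k)"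
    and dg: "\<And>i j k l. distinct [i, j, k, l] \<Longrightarrow>
      br (g i j) (br (g i j) (br (g i j) (g k l))) = sc 4 (br (g i j) (g k l))"
    and "tetra_eq s t"
  shows "lie_eval sc br g s = lie_eval sc br g t"
proof -
  interpret lie_algebra sc br by fact
  from \<open>tetra_eq s t\<close> show ?thesis
  proof induction
    case (Br_Jacobi s t u)
    then show ?case using jacobi by (simp add: add.assoc)
  next
    case (rel_skew i j)
    then show ?case using skew by (simp add: Abs_edge_inverse)
  next
    case (rel_triangle i j k)
    then show ?case using tri by (simp add: Abs_edge_inverse)
  next
    case (rel_Dolan_Grady i j k l)
    then show ?case using dg[of i j k l] by (simp add: Abs_edge_inverse)
  qed (simp_all add: bracket_add_left bracket_add_right bracket_scale_left bracket_scale_right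
        bracket_self scale_left_distrib scale_right_distrib add_ac)
qed

lemma tetra_universal:
  assumes L: "lie_algebra sc br"
    and skew: "\<And>i j. i \<noteq> j \<Longrightarrow> g i j + g j i = 0"
    and tri: "\<And>i j k. distinct [i, j, k] \<Longrightarrow> br (g i j) (g j k) = sc 2 (g i j) + sc 2 (g j k)"
    and dg: "\<And>i j k l. distinct [i, j, k, l] \<Longrightarrow>
      br (g i j) (br (g i j) (br (g i j) (g k l))) = sc 4 (br (g i j) (g k l))"
  shows "\<exists>!\<phi>. lie_hom tetra_scale tetra_bracket sc br \<phi> \<and> (\<forall>i j. i \<noteq> j \<longrightarrow> \<phi> (tetra_x i j) = g i j)"
proof (rule ex_ex1I)
  interpret L: lie_algebra sc br by fact
  interpret T: lie_algebra "tetra_scale :: 'a \<Rightarrow> _" tetra_bracket by (rule lie_algebra_tetra)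
  note cong = lie_eval_cong[OF L skew tri dg]
  define \<phi> where "\<phi> \<xi> = lie_eval sc br g (rep_tetra \<xi>)" for \<xi>
  have \<phi>_abs: "\<phi> (abs_tetra t) = lie_eval sc br g t" for t
    unfolding \<phi>_def
    by (rule cong) (auto intro: Quotient_rep_abs[OF Quotient_tetra] tetra_eq.refl)
  have abs: "\<exists>t. \<xi> = abs_tetra t" for \<xi> :: "'a tetra"
    by (metis Quotient_abs_rep[OF Quotient_tetra])
  have "\<phi> (\<xi> + \<eta>) = \<phi> \<xi> + \<phi> \<eta>" "\<phi> (tetra_scale c \<xi>) = sc c (\<phi> \<xi>)"
    "\<phi> (tetra_bracket \<xi> \<eta>) = br (\<phi> \<xi>) (\<phi> \<eta>)" for \<xi> \<eta> c
    using abs[of \<xi>] abs[of \<eta>]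
    by (auto simp: plus_tetra.abs_eq tetra_scale.abs_eq tetra_bracket.abs_eq \<phi>_abs)
  moreover have "i \<noteq> j \<Longrightarrow> \<phi> (tetra_x i j) = g i j" for i j
    by (simp add: tetra_x.abs_eq \<phi>_abs lie_eval_XG del: lie_eval.simps(1))
  ultimately show "\<exists>\<phi>. lie_hom tetra_scale tetra_bracket sc br \<phi> \<and>
      (\<forall>i j. i \<noteq> j \<longrightarrow> \<phi> (tetra_x i j) = g i j)"
    by (intro exI[of _ \<phi>])
       (auto simp: lie_hom_def Vector_Spaces.linear_def module_hom_def module_hom_axioms_def
          L.module_axioms T.module_axioms T.vector_space_axioms L.vector_space_axioms)
next
  fix \<phi> \<psi> :: "'a tetra \<Rightarrow> 'b"
  assume *: "lie_hom tetra_scale tetra_bracket sc br \<phi> \<and> (\<forall>i j. i \<noteq> j \<longrightarrow> \<phi> (tetra_x i j) = g i j)"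
    "lie_hom tetra_scale tetra_bracket sc br \<psi> \<and> (\<forall>i j. i \<noteq> j \<longrightarrow> \<psi> (tetra_x i j) = g i j)"
  interpret f: Vector_Spaces.linear tetra_scale sc \<phi> using * by (simp add: lie_hom_def)
  interpret h: Vector_Spaces.linear tetra_scale sc \<psi> using * by (simp add: lie_hom_def)
  have "\<phi> (abs_tetra t) = \<psi> (abs_tetra t)" for t
  proof (induction t)
    case (Gen e)
    obtain i j where "Rep_edge e = (i, j)" by (cases "Rep_edge e")
    then have "e = Abs_edge (i, j)" "i \<noteq> j"
      using Rep_edge[of e] Rep_edge_inverse[of e] by auto
    then show ?case using * by (auto simp flip: tetra_x.abs_eq)
  next
    case Zero
    then show ?case using f.zero h.zero by (simp flip: zero_tetra.abs_eq)
  next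
    case (Plus s t)
    then show ?case by (simp flip: plus_tetra.abs_eq add: f.add h.add)
  next
    case (Scale c s)
    then show ?case by (simp flip: tetra_scale.abs_eq add: f.scale h.scale)
  next
    case (Br s t)
    then show ?case using * by (simp flip: tetra_bracket.abs_eq add: lie_hom_def)
  qed
  then show "\<phi> = \<psi>"
    by (metis (no_types) ext Quotient_abs_rep[OF Quotient_tetra])
qed


section \<open>The Lie algebra of traceless two by two matrices\<close>

typedef (overloaded) 'a sl2 = "{A :: 'a::field ^ 2 ^ 2. trace A = 0}"
  by (rule exI[of _ 0]) (simp add: trace_def)

setup_lifting type_definition_sl2

instantiation sl2 :: (field) ab_group_add
begin

lift_definition zero_sl2 :: "'a sl2" is 0 by (simp add: trace_def)
lift_definition plus_sl2 :: "'a sl2 \<Rightarrow> 'a sl2 \<Rightarrow> 'a sl2" is "(+)" by (simp add: trace_add)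
lift_definition uminus_sl2 :: "'a sl2 \<Rightarrow> 'a sl2" is uminus
  by (simp add: trace_def sum_negf)
lift_definition minus_sl2 :: "'a sl2 \<Rightarrow> 'a sl2 \<Rightarrow> 'a sl2" is "(-)" by (simp add: trace_sub)

instance by standard (transfer, simp)+

end

lift_definition sl2_scale :: "'a::field \<Rightarrow> 'a sl2 \<Rightarrow> 'a sl2" is "\<lambda>c A. \<chi> i j. c * A $ i $ j"
  by (simp only: trace_def vec_lambda_beta sum_distrib_left[symmetric] mult_zero_right)

lift_definition sl2_bracket :: "'a::field sl2 \<Rightarrow> 'a sl2 \<Rightarrow> 'a sl2" is "\<lambda>A B. A ** B - B ** A"
  by (metis trace_sub trace_mul_sym diff_self)

lift_definition sl2_e :: "'a::field sl2" is "vector [vector [0, 1], vector [0, 0]]"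
  by (simp add: trace_def sum_2)
lift_definition sl2_f :: "'a::field sl2" is "vector [vector [0, 0], vector [1, 0]]"
  by (simp add: trace_def sum_2)
lift_definition sl2_h :: "'a::field sl2" is "vector [vector [1, 0], vector [0, -1]]"
  by (simp add: trace_def sum_2)


lemma sl2_eq_iff: "A = B \<longleftrightarrow>
    (\<forall>i j. Rep_sl2 A $ i $ j = Rep_sl2 B $ i $ j)"
  by (simp add: vec_eq_iff flip: Rep_sl2_inject)

lemma Rep_sl2_bracket: "Rep_sl2 (sl2_bracket A B) $ i $ j =
    Rep_sl2 A $ i $ 1 * Rep_sl2 B $ 1 $ j + Rep_sl2 A $ i $ 2 * Rep_sl2 B $ 2 $ j -
    (Rep_sl2 B $ i $ 1 * Rep_sl2 A $ 1 $ j + Rep_sl2 B $ i $ 2 * Rep_sl2 A $ 2 $ j)"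
  by (simp add: sl2_bracket.rep_eq matrix_matrix_mult_def sum_2)

lemmas sl2_entries = sl2_eq_iff Rep_sl2_bracket sl2_scale.rep_eq plus_sl2.rep_eq
  minus_sl2.rep_eq uminus_sl2.rep_eq zero_sl2.rep_eq

lemma lie_algebra_sl2: "lie_algebra sl2_scale sl2_bracket"
  by unfold_locales (simp_all add: sl2_entries algebra_simps)

lemma sl2_brackets:
  "sl2_bracket sl2_h sl2_e = sl2_scale 2 sl2_e"
  "sl2_bracket sl2_h sl2_f = sl2_scale (-2) sl2_f"
  "sl2_bracket sl2_e sl2_f = sl2_h"
  by (simp_all add: sl2_entries forall_2 sl2_e.rep_eq sl2_f.rep_eq sl2_h.rep_eq)

definition sl2_x :: "'a::field sl2" where "sl2_x = sl2_scale 2 sl2_e - sl2_h"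
definition sl2_y :: "'a::field sl2" where "sl2_y = sl2_scale (-2) sl2_f - sl2_h"
definition sl2_z :: "'a::field sl2" where "sl2_z = sl2_h"


section \<open>Evaluation modules\<close>

definition is_EV :: "'a::field \<Rightarrow> ('a tetra \<Rightarrow> 'a sl2) \<Rightarrow> bool" where
  "is_EV a \<phi> \<longleftrightarrow> lie_hom tetra_scale tetra_bracket sl2_scale sl2_bracket \<phi> \<and>
     \<phi> (tetra_x I1 I2) = sl2_x \<and>
     \<phi> (tetra_x I2 I3) = sl2_y \<and>
     \<phi> (tetra_x I3 I1) = sl2_z \<and>
     \<phi> (tetra_x I0 I3) = sl2_scale a sl2_y + sl2_scale (a - 1) sl2_z \<and>
     \<phi> (tetra_x I0 I1) = sl2_scale (1 - inverse a) sl2_z - sl2_scale (inverse a) sl2_x \<and>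
     \<phi> (tetra_x I0 I2) = sl2_scale (inverse (1 - a)) sl2_x + sl2_scale (a * inverse (1 - a)) sl2_y"

definition EV :: "'a::field \<Rightarrow> 'a tetra \<Rightarrow> 'a sl2" where
  "EV a = (THE \<phi>. is_EV a \<phi>)"

fun EV_gen :: "'a::field \<Rightarrow> idx \<Rightarrow> idx \<Rightarrow> 'a sl2" where
  "EV_gen a I1 I2 = sl2_x"
| "EV_gen a I2 I3 = sl2_y"
| "EV_gen a I3 I1 = sl2_z"
| "EV_gen a I0 I3 = sl2_scale a sl2_y + sl2_scale (a - 1) sl2_z"
| "EV_gen a I0 I1 = sl2_scale (1 - inverse a) sl2_z - sl2_scale (inverse a) sl2_x"
| "EV_gen a I0 I2 = sl2_scale (inverse (1 - a)) sl2_x + sl2_scale (a * inverse (1 - a)) sl2_y"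
| "EV_gen a I2 I1 = - sl2_x"
| "EV_gen a I3 I2 = - sl2_y"
| "EV_gen a I1 I3 = - sl2_z"
| "EV_gen a I3 I0 = - (sl2_scale a sl2_y + sl2_scale (a - 1) sl2_z)"
| "EV_gen a I1 I0 = - (sl2_scale (1 - inverse a) sl2_z - sl2_scale (inverse a) sl2_x)"
| "EV_gen a I2 I0 = - (sl2_scale (inverse (1 - a)) sl2_x + sl2_scale (a * inverse (1 - a)) sl2_y)"
| "EV_gen a i j = 0"

definition sl2_vec :: "'a::field \<Rightarrow> 'a \<Rightarrow> 'a \<Rightarrow> 'a sl2" where
  "sl2_vec p q r = sl2_scale p sl2_e + sl2_scale q sl2_f + sl2_scale r sl2_h"

lemma Rep_sl2_vec:
  "Rep_sl2 (sl2_vec p q r) $ 1 $ 1 = r" "Rep_sl2 (sl2_vec p q r) $ 1 $ 2 = p"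
  "Rep_sl2 (sl2_vec p q r) $ 2 $ 1 = q" "Rep_sl2 (sl2_vec p q r) $ 2 $ 2 = - r"
  by (simp_all add: sl2_vec_def sl2_entries sl2_e.rep_eq sl2_f.rep_eq sl2_h.rep_eq)

lemma sl2_vec_eq_iff: "sl2_vec p q r = sl2_vec p' q' r' \<longleftrightarrow> p = p' \<and> q = q' \<and> r = r'"
  by (auto simp: sl2_eq_iff forall_2 Rep_sl2_vec)

lemma sl2_vec_ops:
  "0 = sl2_vec 0 0 0"
  "sl2_vec p q r + sl2_vec p' q' r' = sl2_vec (p + p') (q + q') (r + r')"
  "sl2_vec p q r - sl2_vec p' q' r' = sl2_vec (p - p') (q - q') (r - r')"
  "- sl2_vec p q r = sl2_vec (- p) (- q) (- r)"
  "sl2_scale c (sl2_vec p q r) = sl2_vec (c * p) (c * q) (c * r)"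
  "sl2_bracket (sl2_vec p q r) (sl2_vec p' q' r') =
     sl2_vec (2 * (r * p' - p * r')) (2 * (q * r' - r * q')) (p * q' - q * p')"
  by (simp_all add: sl2_entries forall_2 Rep_sl2_vec algebra_simps)

lemma sl2_xyz_vec:
  "sl2_x = sl2_vec 2 0 (-1)" "sl2_y = sl2_vec 0 (-2) (-1)" "sl2_z = sl2_vec 0 0 1"
  by (simp_all add: sl2_x_def sl2_y_def sl2_z_def sl2_entries forall_2 Rep_sl2_vec
        sl2_e.rep_eq sl2_f.rep_eq sl2_h.rep_eq)

lemma EV_gen_skew: "i \<noteq> j \<Longrightarrow> EV_gen a i j + EV_gen a j i = 0"
  by (cases i; cases j) simp_all

lemma EV_gen_triangle:
  assumes "a \<noteq> 0" "a \<noteq> 1" "distinct [i, j, k]"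
  shows "sl2_bracket (EV_gen a i j) (EV_gen a j k) =
           sl2_scale 2 (EV_gen a i j) + sl2_scale 2 (EV_gen a j k)"
proof -
  have "1 - a \<noteq> 0" using assms by simp
  moreover from this have "(1 - a) * (1 - a) \<noteq> 0" "a * ((1 - a) * (1 - a)) \<noteq> 0"
    using assms by simp_all
  then have "1 + a * a - a * 2 \<noteq> 0" "a + a * (a * a) - a * (a * 2) \<noteq> 0"
    by (simp_all add: algebra_simps)
  ultimately show ?thesis using assms
    by (cases i; cases j; cases k)
       (simp_all add: sl2_xyz_vec sl2_vec_ops sl2_vec_eq_iff field_simps)
qed

lemma sl2_vec_ad_cube:
  "sl2_bracket (sl2_vec p q r) (sl2_bracket (sl2_vec p q r)
       (sl2_bracket (sl2_vec p q r) (sl2_vec p' q' r'))) =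
     sl2_scale (4 * (r * r + p * q)) (sl2_bracket (sl2_vec p q r) (sl2_vec p' q' r'))"
  by (simp add: sl2_vec_ops sl2_vec_eq_iff algebra_simps)

lemma sl2_vec_exhaust: "\<exists>p q r. A = sl2_vec p q r"
proof (intro exI)
  have "Rep_sl2 A $ 2 $ 2 = - Rep_sl2 A $ 1 $ 1"
    using Rep_sl2[of A] by (simp add: trace_def sum_2 eq_neg_iff_add_eq_0 add.commute)
  then show "A = sl2_vec (Rep_sl2 A $ 1 $ 2) (Rep_sl2 A $ 2 $ 1) (Rep_sl2 A $ 1 $ 1)"
    by (simp add: sl2_eq_iff forall_2 Rep_sl2_vec)
qed

lemma EV_gen_norm:
  assumes "a \<noteq> 0" "a \<noteq> 1" "i \<noteq> j" "EV_gen a i j = sl2_vec p q r"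
  shows "r * r + p * q = 1"
proof -
  have "1 - a \<noteq> 0" using assms by simp
  have *: "p * q + r * r = 1"
    if "(1 - a) * p = s * 2" "(1 - a) * q = - s * (2 * a)" "(1 - a) * r = - s * (1 + a)" "s * s = 1"
    for s
  proof -
    have "(1 - a) * (1 - a) * (p * q + r * r) =
        ((1 - a) * p) * ((1 - a) * q) + ((1 - a) * r) * ((1 - a) * r)"
      by (simp add: algebra_simps)
    also have "\<dots> = (s * s) * ((1 - a) * (1 - a))"
      unfolding that(1-3) by (simp add: algebra_simps)
    finally show ?thesis using \<open>1 - a \<noteq> 0\<close> that(4) by simp
  qed
  show ?thesis using assms \<open>1 - a \<noteq> 0\<close> *[of 1] *[of "-1"]
    by (cases i; cases j)
       (simp_all add: sl2_xyz_vec sl2_vec_ops sl2_vec_eq_iff, auto simp: field_simps)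
qed

lemma EV_gen_Dolan_Grady:
  assumes "a \<noteq> 0" "a \<noteq> 1" "distinct [i, j, k, l]"
  shows "sl2_bracket (EV_gen a i j) (sl2_bracket (EV_gen a i j)
             (sl2_bracket (EV_gen a i j) (EV_gen a k l))) =
           sl2_scale 4 (sl2_bracket (EV_gen a i j) (EV_gen a k l))"
proof -
  obtain p q r where 1: "EV_gen a i j = sl2_vec p q r" using sl2_vec_exhaust by blast
  obtain p' q' r' where 2: "EV_gen a k l = sl2_vec p' q' r'" using sl2_vec_exhaust by blast
  have "r * r + p * q = 1" using EV_gen_norm[OF assms(1,2) _ 1] assms(3) by simp
  then show ?thesis unfolding 1 2 sl2_vec_ad_cube by simp
qed

lemma is_EV_iff:
  "is_EV a \<phi> \<longleftrightarrow> lie_hom tetra_scale tetra_bracket sl2_scale sl2_bracket \<phi> \<and>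
     (\<forall>i j. i \<noteq> j \<longrightarrow> \<phi> (tetra_x i j) = EV_gen a i j)"
proof
  assume *: "is_EV a \<phi>"
  then interpret f: Vector_Spaces.linear tetra_scale sl2_scale \<phi>
    by (simp add: is_EV_def lie_hom_def)
  have skew: "\<phi> (tetra_x j i) = - \<phi> (tetra_x i j)" if "i \<noteq> j" for i j
  proof -
    have "\<phi> (tetra_x i j) + \<phi> (tetra_x j i) = 0"
      unfolding f.add[symmetric] tetra_x_skew[OF that] by (rule f.zero)
    then show ?thesis by (simp add: eq_neg_iff_add_eq_0 add.commute)
  qed
  have "i \<noteq> j \<Longrightarrow> \<phi> (tetra_x i j) = EV_gen a i j" for i j
    using * skew[of I1 I2] skew[of I2 I3] skew[of I3 I1] skew[of I0 I1] skew[of I0 I2] skew[of I0 I3]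
    by (cases i; cases j) (simp_all add: is_EV_def)
  then show "lie_hom tetra_scale tetra_bracket sl2_scale sl2_bracket \<phi> \<and>
     (\<forall>i j. i \<noteq> j \<longrightarrow> \<phi> (tetra_x i j) = EV_gen a i j)"
    using * by (simp add: is_EV_def)
qed (simp add: is_EV_def)

lemma is_EV_EV:
  assumes "a \<noteq> 0" "a \<noteq> 1"
  shows "is_EV a (EV a)"
proof -
  have "\<exists>!\<phi>. is_EV a \<phi>"
    unfolding is_EV_iff
    by (rule tetra_universal[OF lie_algebra_sl2 EV_gen_skew
          EV_gen_triangle[OF assms] EV_gen_Dolan_Grady[OF assms]])
  then show ?thesis unfolding EV_def by (rule theI')
qed

text \<open>\<open>U\<close> is a copy of \<open>V\<^sub>d(a)\<close>, where \<open>V\<^sub>d\<close> is the irreducible \<open>sl\<^sub>2\<close>-module of dimension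
  \<open>d + 1\<close>, which is unique up to isomorphism.  Since \<open>dim\<close> is \<open>0\<close> on infinite-dimensional
  spaces, the dimension condition includes finite-dimensionality.\<close>

definition evaluation_module ::
  "nat \<Rightarrow> 'a::field \<Rightarrow> ('a \<Rightarrow> 'u::ab_group_add \<Rightarrow> 'u) \<Rightarrow> 'u set \<Rightarrow> ('a tetra \<Rightarrow> 'u \<Rightarrow> 'u) \<Rightarrow> bool" where
  "evaluation_module d a smulU U actU \<longleftrightarrow>
     d \<ge> 1 \<and> a \<noteq> 0 \<and> a \<noteq> 1 \<and>
     (\<exists>\<sigma>. lie_module sl2_scale sl2_bracket smulU U \<sigma> \<and>
          irreducible_module smulU U \<sigma> \<and>
          vector_space.dim smulU U = d + 1 \<and>
          (\<forall>\<xi>. \<forall>u\<in>U. actU \<xi> u = \<sigma> (EV a \<xi>) u))"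


section \<open>Diameter and shape\<close>

definition module_diameter ::
  "('a::field \<Rightarrow> 'v::ab_group_add \<Rightarrow> 'v) \<Rightarrow> 'v set \<Rightarrow> ('a tetra \<Rightarrow> 'v \<Rightarrow> 'v) \<Rightarrow> nat" where
  "module_diameter smul V act =
     (THE d. \<forall>i j. i \<noteq> j \<longrightarrow>
        eigenvalues smul V (act (tetra_x i j)) = {of_nat d - 2 * of_nat n | n. n \<le> d})"

text \<open>For \<open>n\<close> at most the diameter this is \<open>\<rho>\<^sub>n\<close>.\<close>

definition module_shape ::
  "('a::field \<Rightarrow> 'v::ab_group_add \<Rightarrow> 'v) \<Rightarrow> 'v set \<Rightarrow> ('a tetra \<Rightarrow> 'v \<Rightarrow> 'v) \<Rightarrow> nat \<Rightarrow> nat" where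
  "module_shape smul V act n =
     (THE r. \<forall>i j. i \<noteq> j \<longrightarrow>
        vector_space.dim smul
          (eigenspace smul V (act (tetra_x i j))
             (2 * of_nat n - of_nat (module_diameter smul V act))) = r)"

end

theory Submission
  imports Defs
begin

text \<open>Every \<open>x\<^sub>i\<^sub>j\<close> is mapped by \<open>EV\<^sub>a\<close> to a traceless matrix with square \<open>1\<close>, that is, to the
  semisimple member of an \<open>sl\<^sub>2\<close>-triple.  By highest weight theory it is diagonalizable on \<open>V\<^sub>d\<close>
  with the simple eigenvalues \<open>2 k - d\<close>, \<open>0 \<le> k \<le> d\<close>.  The tensor products of eigenvectors form a
  basis of \<open>V\<close> on which \<open>x\<^sub>i\<^sub>j\<close> has the eigenvalue \<open>2 (\<Sum>m\<^sub>k) - \<Sum>d\<^sub>k\<close> at the index \<open>m\<close>.  So \<open>\<rho>\<^sub>n\<close>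
  counts the \<open>m\<close> with \<open>0 \<le> m\<^sub>k \<le> d\<^sub>k\<close> and \<open>\<Sum>m\<^sub>k = n\<close>, which is the coefficient of \<open>\<lambda>\<^sup>n\<close> in the
  product.\<close>

section \<open>Families of vectors and eigenbases\<close>

text \<open>Families indexed by \<open>M\<close> are used instead of sets of vectors, so that an
  index can carry an eigenvalue and a dimension becomes the cardinality of an index set.\<close>

definition independent_family ::
  "('a::field \<Rightarrow> 'v::ab_group_add \<Rightarrow> 'v) \<Rightarrow> 'm set \<Rightarrow> ('m \<Rightarrow> 'v) \<Rightarrow> bool" where
  "independent_family smul M f \<longleftrightarrow>
     finite M \<and> (\<forall>c. (\<Sum>m\<in>M. smul (c m) (f m)) = 0 \<longrightarrow> (\<forall>m\<in>M. c m = 0))"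

definition basis_family ::
  "('a::field \<Rightarrow> 'v::ab_group_add \<Rightarrow> 'v) \<Rightarrow> 'v set \<Rightarrow> 'm set \<Rightarrow> ('m \<Rightarrow> 'v) \<Rightarrow> bool" where
  "basis_family smul V M f \<longleftrightarrow>
     independent_family smul M f \<and> V = range (\<lambda>c. \<Sum>m\<in>M. smul (c m) (f m))"

lemma independent_familyD:
  assumes "independent_family smul M f" "(\<Sum>m\<in>M. smul (c m) (f m)) = 0" "m \<in> M"
  shows "c m = 0"
  using assms unfolding independent_family_def by blast

section \<open>Finite families: dimension, reindexing, coordinates\<close>

context vector_space
begin

text \<open>A repeated vector would give a nontrivial relation with coefficients 1 and -1.
  Injectivity allows indices to be counted in place of vectors.\<close>

lemma independent_family_inj_on:
  assumes "independent_family scale M f"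
  shows "inj_on f M"
proof (rule inj_onI, rule ccontr)
  fix m m' assume *: "m \<in> M" "m' \<in> M" "f m = f m'" "m \<noteq> m'"
  define c where "c = (\<lambda>k. if k = m then 1 else if k = m' then - 1 else 0 :: 'a)"
  have fin: "finite M" using assms by (simp add: independent_family_def)
  have "(\<Sum>k\<in>M. scale (c k) (f k)) = (\<Sum>k\<in>{m, m'}. scale (c k) (f k))"
    by (rule sum.mono_neutral_right) (use * fin in \<open>auto simp: c_def\<close>)
  also have "\<dots> = 0" using * by (simp add: c_def)
  finally have "c m = 0" using assms * by (auto simp: independent_family_def)
  then show False by (simp add: c_def)
qed

lemma independent_family_imp_independent:
  assumes "independent_family scale M f"
  shows "independent (f ` M)"
proof (rule independent_if_scalars_zero)
  show "finite (f ` M)" using assms by (simp add: independent_family_def)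
  fix g v assume *: "(\<Sum>x\<in>f ` M. scale (g x) x) = 0" "v \<in> f ` M"
  then have "(\<Sum>m\<in>M. scale (g (f m)) (f m)) = 0"
    by (simp add: sum.reindex[OF independent_family_inj_on[OF assms]])
  then show "g v = 0" using assms * by (auto simp: independent_family_def)
qed

lemma independent_family_card_le:
  assumes "independent_family scale M f" "f ` M \<subseteq> span B" "finite B"
  shows "card M \<le> card B"
  using independent_span_bound[OF assms(3) independent_family_imp_independent[OF assms(1)] assms(2)]
    card_image[OF independent_family_inj_on[OF assms(1)]] by simp

lemma range_family_sum_eq_span:
  assumes "finite M"
  shows "range (\<lambda>c. \<Sum>m\<in>M. scale (c m) (f m)) = span (f ` M)"
proof (intro antisym subsetI)
  fix v assume "v \<in> range (\<lambda>c. \<Sum>m\<in>M. scale (c m) (f m))"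
  then show "v \<in> span (f ` M)" by (auto intro!: span_sum span_scale intro: span_base)
next
  fix v assume "v \<in> span (f ` M)"
  then show "v \<in> range (\<lambda>c. \<Sum>m\<in>M. scale (c m) (f m))"
  proof (induction rule: span_induct_alt)
    case base
    show ?case by (rule range_eqI[of _ _ "\<lambda>_. 0"]) simp
  next
    case (step c x y)
    then obtain k g where k: "k \<in> M" "x = f k" "y = (\<Sum>m\<in>M. scale (g m) (f m))" by auto
    have "scale c x = (\<Sum>m\<in>M. scale (if m = k then c else 0) (f m))"
      using assms k by (simp add: if_distrib[of "\<lambda>z. scale z _"] cong: if_cong)
    then have "scale c x + y = (\<Sum>m\<in>M. scale ((if m = k then c else 0) + g m) (f m))"
      using k by (simp add: scale_left_distrib sum.distrib)
    then show ?case by (rule range_eqI[of _ _ "\<lambda>m. (if m = k then c else 0) + g m"])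
  qed
qed

lemma basis_family_mem:
  assumes "basis_family scale V M f" "m \<in> M"
  shows "f m \<in> V"
proof -
  have "finite M" using assms by (simp add: basis_family_def independent_family_def)
  then show ?thesis using assms range_family_sum_eq_span[of M f]
    by (auto simp: basis_family_def intro: span_base)
qed

lemma dim_basis_family:
  assumes "basis_family scale V M f"
  shows "dim V = card M"
proof -
  have "independent_family scale M f" "finite M"
    using assms by (simp_all add: basis_family_def independent_family_def)
  moreover have "V = span (f ` M)"
    using assms range_family_sum_eq_span[OF \<open>finite M\<close>] by (simp add: basis_family_def)
  ultimately show ?thesis
    using dim_span_eq_card_independent[OF independent_family_imp_independent, of M f]
      card_image[OF independent_family_inj_on, of M f] by simp
qed

text \<open>Serves to reverse a basis of weight vectors, which arises with decreasing weights but is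
  wanted with increasing ones.\<close>

lemma basis_family_reindex:
  assumes "bij_betw h K M" "basis_family scale V M f"
  shows "basis_family scale V K (f \<circ> h)"
proof -
  have fin: "finite K" "finite M"
    using assms bij_betw_finite by (auto simp: basis_family_def independent_family_def)
  have img: "f ` h ` K = f ` M" using assms(1) by (simp add: bij_betw_imp_surj_on)
  have "independent_family scale K (f \<circ> h)"
    unfolding independent_family_def
  proof (intro conjI allI impI ballI fin)
    fix c k assume *: "(\<Sum>k\<in>K. scale (c k) ((f \<circ> h) k)) = 0" "k \<in> K"
    have inv: "inv_into K h (h k) = k" if "k \<in> K" for k
      using assms(1) that by (simp add: bij_betw_def)
    have "(\<Sum>m\<in>M. scale (c (inv_into K h m)) (f m)) = (\<Sum>k\<in>K. scale (c k) ((f \<circ> h) k))"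
      by (subst sum.reindex_bij_betw[OF assms(1), symmetric]) (simp add: inv cong: sum.cong)
    then have "c (inv_into K h (h k)) = 0"
      using * assms independent_familyD[of scale M f "\<lambda>m. c (inv_into K h m)" "h k"]
      by (auto simp: basis_family_def bij_betw_def)
    then show "c k = 0" using inv * by simp
  qed
  then show ?thesis
    using assms(2) range_family_sum_eq_span[OF fin(1), of "f \<circ> h"] range_family_sum_eq_span[OF fin(2), of f]
    by (simp add: basis_family_def img[unfolded image_image])
qed

text \<open>Coordinates are first picked by choice; independence makes them unique, and uniqueness
  forces linearity. They are the factors of the multilinear functionals that separate tensors of
  basis vectors.\<close>

lemma basis_family_coordinates:
  assumes "basis_family scale V M f"
  shows "\<exists>coord. (\<forall>v\<in>V. \<forall>w\<in>V. \<forall>m\<in>M. coord (v + w) m = coord v m + coord w m) \<and>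
    (\<forall>c. \<forall>v\<in>V. \<forall>m\<in>M. coord (scale c v) m = c * coord v m) \<and>
    (\<forall>k\<in>M. \<forall>m\<in>M. coord (f k) m = (if m = k then 1 else 0))"
proof -
  have fin: "finite M" using assms by (simp add: basis_family_def independent_family_def)
  have sub: "subspace V"
    using assms range_family_sum_eq_span[OF fin, of f] by (simp add: basis_family_def)
  have ex: "\<exists>c. v = (\<Sum>m\<in>M. scale (c m) (f m))" if "v \<in> V" for v
    using assms that by (auto simp: basis_family_def)
  then obtain coord where c: "\<And>v. v \<in> V \<Longrightarrow> v = (\<Sum>m\<in>M. scale (coord v m) (f m))"
    by metis
  have uniq: "c m = c' m"
    if "(\<Sum>m\<in>M. scale (c m) (f m)) = (\<Sum>m\<in>M. scale (c' m) (f m))" "m \<in> M" for c c' m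
  proof -
    have "(\<Sum>m\<in>M. scale (c m - c' m) (f m)) = 0"
      using that by (simp add: scale_left_diff_distrib sum_subtractf)
    then show ?thesis using assms that
      by (auto simp: basis_family_def independent_family_def dest!: spec[of _ "\<lambda>m. c m - c' m"])
  qed
  show ?thesis
  proof (intro exI[of _ coord] conjI ballI allI)
    fix v w m assume *: "v \<in> V" "w \<in> V" "m \<in> M"
    show "coord (v + w) m = coord v m + coord w m"
      by (rule uniq[of _ "\<lambda>m. coord v m + coord w m"])
         (use * sub c[of "v + w"] c[of v] c[of w] in
           \<open>simp_all add: scale_left_distrib sum.distrib subspace_add\<close>)
  next
    fix a v m assume *: "v \<in> V" "m \<in> M"
    have "(\<Sum>m\<in>M. scale (a * coord v m) (f m)) = scale a v"
      using c[OF *(1)] by (metis (mono_tags, lifting) scale_scale scale_sum_right sum.cong)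
    then show "coord (scale a v) m = a * coord v m"
      by (intro uniq[of _ "\<lambda>m. a * coord v m"])
         (use * sub c[of "scale a v"] in \<open>simp_all add: subspace_scale\<close>)
  next
    fix k m assume *: "k \<in> M" "m \<in> M"
    show "coord (f k) m = (if m = k then 1 else 0)"
      by (rule uniq[of _ "\<lambda>m. if m = k then 1 else 0"])
         (use * fin c[OF basis_family_mem[OF assms], of k] in
           \<open>simp_all add: if_distrib[of "\<lambda>z. scale z _"] cong: if_cong\<close>)
  qed
qed

end

text \<open>The action of a module is specified only on its carrier, so \<open>T\<close> is a map of
  the whole type of which linearity is known on \<open>V\<close> alone.\<close>

locale subspace_endo = vector_space scale
  for scale :: "'a::field \<Rightarrow> 'v::ab_group_add \<Rightarrow> 'v" +
  fixes V :: "'v set" and T :: "'v \<Rightarrow> 'v"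
  assumes subspace: "subspace V"
    and closed: "v \<in> V \<Longrightarrow> T v \<in> V"
    and add: "v \<in> V \<Longrightarrow> w \<in> V \<Longrightarrow> T (v + w) = T v + T w"
    and scale: "v \<in> V \<Longrightarrow> T (scale c v) = scale c (T v)"
begin

lemma zero: "T 0 = 0"
  using scale[of 0 0] subspace by (simp add: subspace_0)

lemma sum_scale:
  assumes "\<And>m. m \<in> M \<Longrightarrow> f m \<in> V"
  shows "T (\<Sum>m\<in>M. scale (c m) (f m)) = (\<Sum>m\<in>M. scale (c m) (T (f m)))"
  using assms
proof (induction M rule: infinite_finite_induct)
  case (insert x M)
  then have "scale (c x) (f x) \<in> V" "(\<Sum>m\<in>M. scale (c m) (f m)) \<in> V"
    using subspace by (auto intro!: subspace_scale subspace_sum)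
  then show ?case using insert by (simp add: add scale)
qed (simp_all add: zero)

lemma funpow_closed: "v \<in> V \<Longrightarrow> (T ^^ n) v \<in> V"
  by (induction n) (auto intro: closed)

text \<open>Applying \<open>T\<close> minus the scalar \<open>\<mu> x\<close> to a relation kills
  the term at \<open>x\<close> and multiplies every other coefficient by the nonzero
  \<open>\<mu> m - \<mu> x\<close>; induction on the index set then applies.\<close>

lemma eigenvectors_independent:
  assumes "finite M" "inj_on \<mu> M"
    and "\<And>m. m \<in> M \<Longrightarrow> f m \<in> V \<and> f m \<noteq> 0 \<and> T (f m) = scale (\<mu> m) (f m)"
  shows "independent_family scale M f"
proof -
  have "\<forall>m\<in>M. c m = 0" if "(\<Sum>m\<in>M. scale (c m) (f m)) = 0" for c
    using assms that
  proof (induction M arbitrary: c)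
    case (insert x M)
    let ?s = "\<Sum>m\<in>insert x M. scale (c m) (f m)"
    have "0 = T ?s - scale (\<mu> x) ?s" unfolding insert.prems(3) by (simp add: zero)
    also have "T ?s = (\<Sum>m\<in>insert x M. scale (c m) (scale (\<mu> m) (f m)))"
      using insert.prems by (subst sum_scale) auto
    also have "\<dots> - scale (\<mu> x) ?s = (\<Sum>m\<in>insert x M. scale (c m * (\<mu> m - \<mu> x)) (f m))"
      unfolding scale_sum_right by (simp only: flip: sum_subtractf) (simp add: algebra_simps)
    also have "\<dots> = (\<Sum>m\<in>M. scale (c m * (\<mu> m - \<mu> x)) (f m))"
      using insert.hyps by simp
    finally have "\<forall>m\<in>M. c m * (\<mu> m - \<mu> x) = 0"
      using insert.prems by (intro insert.IH) auto
    moreover have "\<forall>m\<in>M. \<mu> m \<noteq> \<mu> x" using insert.prems(1) insert.hyps(2) by (auto simp: image_iff)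
    ultimately have *: "\<forall>m\<in>M. c m = 0" by auto
    then have "scale (c x) (f x) = 0" using insert.prems(3) insert.hyps by simp
    then show ?case using * insert.prems by simp
  qed simp
  then show ?thesis using assms(1) by (simp add: independent_family_def)
qed

text \<open>Applying \<open>T\<close> minus the scalar \<open>c\<close> to a combination multiplies
  the coefficient at \<open>m\<close> by \<open>\<mu> m - c\<close>. So the eigenvectors for
  \<open>c\<close> are the nonzero combinations supported on the indices with
  \<open>\<mu> m = c\<close>, and these indices give a basis of the eigenspace.\<close>

lemma
  assumes "basis_family scale V M f" "\<And>m. m \<in> M \<Longrightarrow> T (f m) = scale (\<mu> m) (f m)"
  shows dim_eigenspace_eigenbasis: "dim (eigenspace scale V T c) = card {m \<in> M. \<mu> m = c}"
    and eigenvalues_eigenbasis: "eigenvalues scale V T = \<mu> ` M"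
proof -
  have fin: "finite M" using assms by (simp add: basis_family_def independent_family_def)
  have f: "f m \<in> V" "f m \<noteq> 0" if "m \<in> M" for m
  proof -
    show "f m \<in> V" using basis_family_mem[OF assms(1) that] .
    show "f m \<noteq> 0"
    proof
      assume "f m = 0"
      then have "(\<Sum>k\<in>M. scale (if k = m then 1 else 0) (f k)) = 0"
        by (intro sum.neutral) auto
      then show False using assms(1) that
        by (force simp: basis_family_def independent_family_def
            dest!: spec[of _ "\<lambda>k. if k = m then 1 else 0"])
    qed
  qed
  have supp: "\<forall>m\<in>M. g m \<noteq> 0 \<longrightarrow> \<mu> m = c"
    if "T (\<Sum>m\<in>M. scale (g m) (f m)) = scale c (\<Sum>m\<in>M. scale (g m) (f m))" for g c
  proof -
    have "0 = T (\<Sum>m\<in>M. scale (g m) (f m)) - scale c (\<Sum>m\<in>M. scale (g m) (f m))"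
      using that by simp
    also have "\<dots> = (\<Sum>m\<in>M. scale (g m) (scale (\<mu> m) (f m))) - scale c (\<Sum>m\<in>M. scale (g m) (f m))"
      using f assms(2) by (subst sum_scale) auto
    also have "\<dots> = (\<Sum>m\<in>M. scale (g m * (\<mu> m - c)) (f m))"
      unfolding scale_sum_right by (simp only: flip: sum_subtractf) (simp add: algebra_simps)
    finally have "(\<Sum>m\<in>M. scale (g m * (\<mu> m - c)) (f m)) = 0" ..
    then have "\<forall>m\<in>M. g m * (\<mu> m - c) = 0"
      using assms(1) independent_familyD[of scale M f "\<lambda>m. g m * (\<mu> m - c)"]
      by (auto simp: basis_family_def)
    then show ?thesis by auto
  qed
  let ?M = "{m \<in> M. \<mu> m = c}"
  have "basis_family scale (eigenspace scale V T c) ?M f"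
    unfolding basis_family_def
  proof
    show "independent_family scale ?M f"
      unfolding independent_family_def
    proof (intro conjI allI impI)
      fix g assume *: "(\<Sum>m\<in>?M. scale (g m) (f m)) = 0"
      \<comment> \<open>Extension by zero turns a relation on \<open>?M\<close> into one on all of
        \<open>M\<close>.\<close>
      have "(\<Sum>m\<in>M. scale (if \<mu> m = c then g m else 0) (f m)) = 0"
        using * fin by (simp add: sum.inter_filter if_distrib[of "\<lambda>z. scale z _"] cong: if_cong)
      then have "(if \<mu> m = c then g m else 0) = 0" if "m \<in> M" for m
        using assms(1) that independent_familyD[of scale M f "\<lambda>m. if \<mu> m = c then g m else 0" m]
        by (simp only: basis_family_def)
      then show "\<forall>m\<in>?M. g m = 0" by (metis (mono_tags, lifting) mem_Collect_eq)
    qed (use fin in simp)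
    show "eigenspace scale V T c = range (\<lambda>g. \<Sum>m\<in>?M. scale (g m) (f m))"
    proof (intro antisym subsetI)
      fix v assume "v \<in> eigenspace scale V T c"
      then obtain g where g: "v = (\<Sum>m\<in>M. scale (g m) (f m))" "T v = scale c v"
        using assms(1) by (auto simp: eigenspace_def basis_family_def)
      have "v = (\<Sum>m\<in>?M. scale (g m) (f m))"
        unfolding g by (rule sum.mono_neutral_right) (use fin supp[of g c] g in auto)
      then show "v \<in> range (\<lambda>g. \<Sum>m\<in>?M. scale (g m) (f m))" by blast
    next
      fix v assume "v \<in> range (\<lambda>g. \<Sum>m\<in>?M. scale (g m) (f m))"
      then obtain g where g: "v = (\<Sum>m\<in>?M. scale (g m) (f m))" by blast
      have "T v = (\<Sum>m\<in>?M. scale (g m) (T (f m)))"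
        unfolding g by (rule sum_scale) (use f in auto)
      also have "\<dots> = scale c v"
        unfolding g scale_sum_right by (rule sum.cong) (auto simp: assms(2) mult.commute)
      finally show "v \<in> eigenspace scale V T c"
        using subspace f by (auto simp: eigenspace_def g intro!: subspace_sum subspace_scale)
    qed
  qed
  then show "dim (eigenspace scale V T c) = card ?M" by (rule dim_basis_family)
  show "eigenvalues scale V T = \<mu> ` M"
  proof (intro antisym subsetI)
    fix c assume "c \<in> eigenvalues scale V T"
    then obtain g where g: "(\<Sum>m\<in>M. scale (g m) (f m)) \<noteq> 0"
      "T (\<Sum>m\<in>M. scale (g m) (f m)) = scale c (\<Sum>m\<in>M. scale (g m) (f m))"
      using assms(1) by (auto simp: eigenvalues_def basis_family_def)
    then obtain m where "m \<in> M" "g m \<noteq> 0" by (metis (mono_tags, lifting) scale_zero_left sum.neutral)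
    then show "c \<in> \<mu> ` M" using supp[OF g(2)] by auto
  next
    fix c assume "c \<in> \<mu> ` M"
    then show "c \<in> eigenvalues scale V T" using f assms(2) by (auto simp: eigenvalues_def)
  qed
qed

text \<open>Multiplying a polynomial by the indeterminate amounts to applying \<open>T\<close> once
  more. The strict degree bound makes the coefficient of \<open>q\<close> at \<open>n\<close>
  vanish, so truncation at \<open>n\<close> loses nothing in the shift.\<close>

lemma funpow_sum_pCons:
  assumes "w \<in> V" "degree q < n"
  shows "(\<Sum>i\<le>n. scale (coeff (pCons 0 q) i) ((T ^^ i) w)) =
    T (\<Sum>i\<le>n. scale (coeff q i) ((T ^^ i) w))"
proof -
  obtain k where n: "n = Suc k" using assms(2) by (cases n) auto
  have "(\<Sum>i\<le>n. scale (coeff (pCons 0 q) i) ((T ^^ i) w)) =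
      (\<Sum>i\<le>k. scale (coeff q i) (T ((T ^^ i) w)))"
    unfolding n by (subst sum.atMost_Suc_shift) simp
  also have "\<dots> = (\<Sum>i\<le>n. scale (coeff q i) (T ((T ^^ i) w)))"
    using assms(2) by (simp add: n coeff_eq_0)
  also have "\<dots> = T (\<Sum>i\<le>n. scale (coeff q i) ((T ^^ i) w))"
    by (rule sum_scale[symmetric]) (rule funpow_closed[OF assms(1)])
  finally show ?thesis .
qed

end

text \<open>The iterates of \<open>w\<close> under \<open>T\<close> satisfy a linear relation, that
  is, a nonzero polynomial in \<open>T\<close> kills \<open>w\<close>. Linear factors are split off
  one at a time; the first quotient that no longer kills \<open>w\<close> sends it to an
  eigenvector.\<close>

lemma eigenvector_exists:
  fixes smul :: "'a::alg_closed_field \<Rightarrow> 'v::ab_group_add \<Rightarrow> 'v"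
  assumes "subspace_endo smul V T" "finite B" "V \<subseteq> module.span smul B" "w \<in> V" "w \<noteq> 0"
  shows "\<exists>c. \<exists>v\<in>V. v \<noteq> 0 \<and> T v = smul c v"
proof -
  interpret subspace_endo smul V T by fact
  define n where "n = card B"
  define ev where "ev p = (\<Sum>i\<le>n. smul (coeff p i) ((T ^^ i) w))" for p
  have ev_V: "ev p \<in> V" for p
    unfolding ev_def using subspace funpow_closed[OF assms(4)] by (intro subspace_sum subspace_scale)
  \<comment> \<open>The index set has \<open>n + 1\<close> elements, one more than
    \<open>B\<close>.\<close>
  have "\<not> independent_family smul {..n} (\<lambda>i. (T ^^ i) w)"
    using independent_family_card_le[OF _ _ assms(2), of "{..n}" "\<lambda>i. (T ^^ i) w"]
      funpow_closed[OF assms(4)] assms(3) by (auto simp: n_def)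
  then obtain c k where c: "(\<Sum>i\<le>n. smul (c i) ((T ^^ i) w)) = 0" "k \<le> n" "c k \<noteq> 0"
    by (auto simp: independent_family_def)
  define p where "p = (\<Sum>i\<le>n. monom (c i) i)"
  have coeff_p: "coeff p i = (if i \<le> n then c i else 0)" for i
    by (simp add: p_def coeff_sum if_distrib cong: if_cong)
  have "ev p = 0" "p \<noteq> 0" "degree p \<le> n"
  proof -
    show "ev p = 0" using c by (simp add: ev_def coeff_p)
    show "p \<noteq> 0" using c coeff_p[of k] by auto
    show "degree p \<le> n" by (rule degree_le) (simp add: coeff_p)
  qed
  then show ?thesis
  proof (induction "degree p" arbitrary: p rule: less_induct)
    case less
    \<comment> \<open>A nonzero constant polynomial cannot kill the nonzero vector
      \<open>w\<close>.\<close>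
    have "degree p > 0"
    proof (rule ccontr)
      assume "\<not> degree p > 0"
      then obtain b where b: "p = [:b:]" by (auto elim: degree_eq_zeroE)
      have "ev p = (\<Sum>i\<in>{0}. smul (coeff p i) ((T ^^ i) w))"
        unfolding ev_def by (rule sum.mono_neutral_right) (auto simp: b coeff_pCons split: nat.split)
      then show False using less.prems assms(5) by (simp add: b)
    qed
    then obtain c where "poly p c = 0" using alg_closed_imp_poly_has_root by blast
    then obtain q where q: "p = [:- c, 1:] * q" by (auto simp: poly_eq_0_iff_dvd)
    have "q \<noteq> 0" using less.prems q by auto
    have deg: "degree p = Suc (degree q)"
      unfolding q using \<open>q \<noteq> 0\<close> by (subst degree_mult_eq) auto
    show ?case
    proof (cases "ev q = 0")
      case True
      then show ?thesis using less.hyps[of q] deg \<open>q \<noteq> 0\<close> less.prems by simp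
    next
      case False
      \<comment> \<open>Evaluating this factorization at \<open>T\<close> shows that
        \<open>T\<close> acts on \<open>ev q\<close> as the scalar \<open>c\<close>.\<close>
      have "p = pCons 0 q - smult c q" unfolding q by simp
      then have "0 = ev (pCons 0 q) - smul c (ev q)"
        using less.prems by (simp add: ev_def scale_sum_right scale_left_diff_distrib sum_subtractf)
      also have "ev (pCons 0 q) = T (ev q)"
        unfolding ev_def using less.prems deg by (intro funpow_sum_pCons assms(4)) auto
      finally show ?thesis using False ev_V by auto
    qed
  qed
qed


section \<open>Irreducible \<open>sl\<^sub>2\<close>-modules\<close>

lemma (in lie_module) subspace_endo_act: "subspace_endo smul V (act \<xi>)"
  by unfold_locales
    (simp_all add: carrier_subspace act_closed act_add_right act_scale_right)

text \<open>By \<open>norm\<close> the traceless matrix squares to 1, so it is conjugate to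
  \<open>sl2_h\<close>; \<open>E\<close> and \<open>F\<close> are the corresponding conjugates of
  \<open>sl2_e\<close> and \<open>sl2_f\<close>. The spanning property later reduces invariance
  under the whole algebra to invariance under the triple.\<close>

lemma sl2_vec_triple:
  fixes p q r :: "'a::field_char_0"
  assumes norm: "r * r + p * q = 1"
  obtains E F where
    "sl2_bracket (sl2_vec p q r) E = sl2_scale 2 E"
    "sl2_bracket (sl2_vec p q r) F = sl2_scale (-2) F"
    "sl2_bracket E F = sl2_vec p q r"
    "\<And>\<xi>. \<exists>\<alpha> \<beta> \<gamma>. \<xi> = sl2_scale \<alpha> E + sl2_scale \<beta> F + sl2_scale \<gamma> (sl2_vec p q r)"
proof -
  have main: "\<exists>E F. sl2_bracket (sl2_vec p q r) E = sl2_scale 2 E \<and>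
    sl2_bracket (sl2_vec p q r) F = sl2_scale (-2) F \<and> sl2_bracket E F = sl2_vec p q r \<and>
    (\<forall>\<xi>. \<exists>\<alpha> \<beta> \<gamma>. \<xi> = sl2_scale \<alpha> E + sl2_scale \<beta> F + sl2_scale \<gamma> (sl2_vec p q r))"
    if norm: "r * r + p * q = 1" and "r \<noteq> -1" for p q r :: 'a
  proof -
    \<comment> \<open>conjugate \<open>e\<close> and \<open>f\<close> by the matrix with columns \<open>(1 + r, q)\<close> and \<open>(-p, 1 + r)\<close>, which
      are eigenvectors of \<open>sl2_vec p q r\<close>\<close>
    define s where "s = 1 + r"
    \<comment> \<open>The determinant of the conjugating matrix is \<open>s * s + p * q\<close>,
      which equals \<open>2 * s\<close> by \<open>norm\<close>.\<close>
    define t where "t = inverse (2 * s)"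
    have "s \<noteq> 0" using \<open>r \<noteq> -1\<close> by (metis add.commute add_eq_0_iff s_def)
    then have st: "2 * s * t = 1" by (simp add: t_def)
    \<comment> \<open>Clears denominators, leaving polynomial identities modulo the value of
      \<open>p * q\<close>.\<close>
    have clear: "w = t * t * A" if "A = 4 * (s * s) * w" for A w using st that by algebra
    have r: "r = s - 1" by (simp add: s_def)
    have pq: "p * q = 2 * s - s * s" using norm unfolding r by (simp add: algebra_simps)
    let ?E = "sl2_vec (s * s * t) (- q * q * t) (- q * s * t)"
    let ?F = "sl2_vec (- p * p * t) (s * s * t) (- p * s * t)"
    have "sl2_bracket (sl2_vec p q r) ?E = sl2_scale 2 ?E"
      unfolding r sl2_vec_ops sl2_vec_eq_iff using pq
      by (intro conjI; (simp add: algebra_simps; fail | algebra))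
    moreover have "sl2_bracket (sl2_vec p q r) ?F = sl2_scale (-2) ?F"
      unfolding r sl2_vec_ops sl2_vec_eq_iff using pq
      by (intro conjI; (simp add: algebra_simps; fail | algebra))
    moreover have "sl2_bracket ?E ?F = sl2_vec p q r"
    proof -
      have "t * t * (2 * (q * s * p * p + s * s * s * p)) = p"
        "t * t * (2 * (q * q * p * s + q * s * s * s)) = q"
        "t * t * (s * s * s * s - q * q * p * p) = s - 1"
        by (rule clear[symmetric]; use pq in algebra)+
      then show ?thesis unfolding r sl2_vec_ops sl2_vec_eq_iff by (simp add: algebra_simps)
    qed
    moreover have "\<exists>\<alpha> \<beta> \<gamma>. \<xi> = sl2_scale \<alpha> ?E + sl2_scale \<beta> ?F + sl2_scale \<gamma> (sl2_vec p q r)" for \<xi>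
    proof -
      obtain x y z where \<xi>: "\<xi> = sl2_vec x y z" using sl2_vec_exhaust by blast
      \<comment> \<open>up to the scalars \<open>t\<close> and \<open>2 * t * t * s * s\<close>, the entries of the matrix that \<open>\<xi>\<close> becomes
        when conjugated back\<close>
      define \<alpha> where "\<alpha> = s * (x * s - z * p) - p * (y * p + z * s)"
      define \<beta> where "\<beta> = s * (y * s - z * q) - q * (z * s + x * q)"
      define \<gamma> where "\<gamma> = 2 * z * (s - 1) + x * q + y * p"
      have "\<alpha> * (s * s) - \<beta> * (p * p) + 2 * (s * s) * \<gamma> * p = 4 * (s * s) * x"
        "- \<alpha> * (q * q) + \<beta> * (s * s) + 2 * (s * s) * \<gamma> * q = 4 * (s * s) * y"
        "- \<alpha> * (q * s) - \<beta> * (p * s) + 2 * (s * s) * \<gamma> * (s - 1) = 4 * (s * s) * z"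
        unfolding \<alpha>_def \<beta>_def \<gamma>_def using pq by algebra+
      note this[THEN clear]
      then have "\<xi> = sl2_scale (t * \<alpha>) ?E + sl2_scale (t * \<beta>) ?F +
          sl2_scale (t * t * (2 * (s * s) * \<gamma>)) (sl2_vec p q r)"
        unfolding \<xi> r sl2_vec_ops sl2_vec_eq_iff by (simp add: algebra_simps)
      then show ?thesis by blast
    qed
    ultimately show ?thesis by blast
  qed
  show ?thesis
  proof (cases "r = -1")
    case False
    then show ?thesis using main[OF norm] that by blast
  next
    \<comment> \<open>Here the conjugating matrix would be singular. The negated matrix has
      \<open>- r = 1\<close>, which differs from -1 in characteristic 0; exchanging \<open>E\<close>
      and \<open>F\<close> then undoes the sign.\<close>
    case True
    interpret lie_algebra "sl2_scale :: 'a \<Rightarrow> _" sl2_bracket by (rule lie_algebra_sl2)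
    let ?A = "sl2_vec p q r"
    have neg: "sl2_vec (- p) (- q) (- r) = - ?A" by (simp add: sl2_vec_ops)
    have "- r \<noteq> -1" using True by simp
    then obtain E F where *: "sl2_bracket (- ?A) E = sl2_scale 2 E"
      "sl2_bracket (- ?A) F = sl2_scale (-2) F" "sl2_bracket E F = - ?A"
      "\<And>\<xi>. \<exists>\<alpha> \<beta> \<gamma>. \<xi> = sl2_scale \<alpha> E + sl2_scale \<beta> F + sl2_scale \<gamma> (- ?A)"
      using main[of "- r" "- p" "- q"] norm unfolding neg by auto
    have skew: "sl2_bracket (- \<xi>) \<eta> = - sl2_bracket \<xi> \<eta>" "sl2_bracket \<xi> \<eta> = - sl2_bracket \<eta> \<xi>"
      for \<xi> \<eta> :: "'a sl2"
      by (simp_all add: sl2_entries)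
    show ?thesis
    proof (rule that[of F E])
      show "sl2_bracket ?A F = sl2_scale 2 F" "sl2_bracket ?A E = sl2_scale (- 2) E"
        using *(1,2) by (simp_all add: skew(1) minus_equation_iff[of _ "sl2_scale _ _"])
      show "sl2_bracket F E = ?A" using *(3) skew(2)[of F E] by simp
      fix \<xi>
      obtain \<alpha> \<beta> \<gamma> where "\<xi> = sl2_scale \<alpha> E + sl2_scale \<beta> F + sl2_scale \<gamma> (- ?A)" using *(4) by blast
      then have "\<xi> = sl2_scale \<beta> F + sl2_scale \<alpha> E + sl2_scale (- \<gamma>) ?A" by (simp add: add_ac)
      then show "\<exists>\<alpha> \<beta> \<gamma>. \<xi> = sl2_scale \<alpha> F + sl2_scale \<beta> E + sl2_scale \<gamma> ?A" by blast
    qed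
  qed
qed

text \<open>A highest weight vector is lowered by \<open>F\<close> until it vanishes. The string
  obtained spans a submodule, which is all of \<open>U\<close> by irreducibility, and its length
  determines the weights.\<close>

lemma sl2_irreducible_eigenbasis:
  fixes smul :: "'a::{alg_closed_field, field_char_0} \<Rightarrow> 'u::ab_group_add \<Rightarrow> 'u"
  assumes mod: "lie_module sl2_scale sl2_bracket smul U \<sigma>"
    and irr: "irreducible_module smul U \<sigma>"
    and dim: "vector_space.dim smul U = d + 1"
    and norm: "r * r + p * q = 1"
  obtains b where "basis_family smul U {..d} b"
    "\<And>k. k \<le> d \<Longrightarrow> \<sigma> (sl2_vec p q r) (b k) = smul (2 * of_nat k - of_nat d) (b k)"
proof -
  interpret lie_module sl2_scale sl2_bracket smul U \<sigma> by fact
  define H where "H = sl2_vec p q r"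
  obtain E F where
    HE: "sl2_bracket H E = sl2_scale 2 E" and
    HF: "sl2_bracket H F = sl2_scale (-2) F" and
    EF: "sl2_bracket E F = H" and
    span: "\<And>\<xi>. \<exists>\<alpha> \<beta> \<gamma>. \<xi> = sl2_scale \<alpha> E + sl2_scale \<beta> F + sl2_scale \<gamma> H"
    using sl2_vec_triple[OF norm] unfolding H_def by metis
  interpret H: subspace_endo smul U "\<sigma> H" by (rule subspace_endo_act)
  interpret E: subspace_endo smul U "\<sigma> E" by (rule subspace_endo_act)
  interpret F: subspace_endo smul U "\<sigma> F" by (rule subspace_endo_act)
  have EH': "\<sigma> H (\<sigma> E v) = \<sigma> E (\<sigma> H v) + smul 2 (\<sigma> E v)" if "v \<in> U" for v
    using act_bracket[OF that, of H E] that by (simp add: HE act_scale_left algebra_simps)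
  have FH': "\<sigma> H (\<sigma> F v) = \<sigma> F (\<sigma> H v) - smul 2 (\<sigma> F v)" if "v \<in> U" for v
    using act_bracket[OF that, of H F] act_scale_left[OF that, of "- 2" F] HF
    by (simp only: M.scale_minus_left) (simp add: algebra_simps)
  have EF': "\<sigma> E (\<sigma> F v) = \<sigma> F (\<sigma> E v) + \<sigma> H v" if "v \<in> U" for v
    using act_bracket[OF that, of E F] that by (simp add: EF algebra_simps)
  obtain B where B: "B \<subseteq> U" "U \<subseteq> M.span B" "card B = d + 1"
    using M.basis_exists[of U] dim by metis
  then have "finite B" by (metis card.infinite add_is_0 one_neq_zero)
  obtain w where "w \<in> U" "w \<noteq> 0"
    using irr carrier_subspace M.subspace_0 by (auto simp: irreducible_module_def)
  then obtain \<mu> v where v: "v \<in> U" "v \<noteq> 0" "\<sigma> H v = smul \<mu> v"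
    using eigenvector_exists[OF subspace_endo_act \<open>finite B\<close> B(2)] by metis
  \<comment> \<open>A sequence of weight vectors whose weights progress by a nonzero step must reach
    0: in characteristic 0 the weights are distinct, so otherwise the \<open>d + 2\<close> vectors
    indexed by \<open>{..d + 1}\<close> would be independent in dimension
    \<open>d + 1\<close>.\<close>
  have weights: "\<exists>n. f n \<noteq> 0 \<and> f (Suc n) = 0"
    if "f 0 \<noteq> 0" "\<And>n. f n \<in> U" "\<And>n. \<sigma> H (f n) = smul (\<nu> + s * of_nat n) (f n)" "s \<noteq> 0" for f \<nu> s
  proof -
    have "\<exists>n. f n = 0"
    proof (rule ccontr)
      assume "\<not> (\<exists>n. f n = 0)"
      then have "independent_family smul {..d + 1} f"
        using that by (intro H.eigenvectors_independent[of _ "\<lambda>n. \<nu> + s * of_nat n"])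
          (auto simp: inj_on_def)
      then have "card {..d + 1} \<le> card B"
        by (rule M.independent_family_card_le) (use that B \<open>finite B\<close> in auto)
      then show False using B by simp
    qed
    moreover have "f n \<noteq> 0" if "\<nexists>n. f n \<noteq> 0 \<and> f (Suc n) = 0" for n
      using that \<open>f 0 \<noteq> 0\<close> by (induction n) auto
    ultimately show ?thesis by blast
  qed

  \<comment> \<open>Raising an eigenvector to a highest weight vector\<close>
  define g where "g n = (\<sigma> E ^^ n) v" for n
  have g_Suc: "\<sigma> E (g n) = g (Suc n)" for n by (simp add: g_def)
  have "g n \<in> U" "\<sigma> H (g n) = smul (\<mu> + 2 * of_nat n) (g n)" for n
  proof (induction n)
    case (Suc n)
    { case 1 show ?case using Suc by (simp add: g_def act_closed) }
    { case 2
      have "\<sigma> H (g (Suc n)) = \<sigma> E (smul (\<mu> + 2 * of_nat n) (g n)) + smul 2 (g (Suc n))"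
        using EH'[OF Suc(1)] Suc(2) by (simp only: g_Suc)
      also have "\<dots> = smul (\<mu> + 2 * of_nat n + 2) (g (Suc n))"
        by (simp only: act_scale_right[OF Suc(1)] g_Suc) (simp only: M.scale_left_distrib)
      finally show ?case by (simp add: algebra_simps) }
  qed (use v in \<open>simp_all add: g_def\<close>)
  \<comment> \<open>The last nonzero vector of the raised sequence is killed by
    \<open>E\<close>.\<close>
  moreover from this obtain n0 where "g n0 \<noteq> 0" "g (Suc n0) = 0"
    using weights[of g \<mu> 2] v by (auto simp: g_def)
  ultimately obtain u \<kappa> where u: "u \<in> U" "u \<noteq> 0" "\<sigma> E u = 0" "\<sigma> H u = smul \<kappa> u"
    by (auto simp: g_def)

  \<comment> \<open>Lowering the highest weight vector\<close>
  define f where "f n = (\<sigma> F ^^ n) u" for n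
  have f_Suc: "\<sigma> F (f n) = f (Suc n)" for n by (simp add: f_def)
  have f: "f n \<in> U" "\<sigma> H (f n) = smul (\<kappa> + (-2) * of_nat n) (f n)" for n
  proof (induction n)
    case (Suc n)
    { case 1 show ?case using Suc by (simp add: f_def act_closed) }
    { case 2
      have "\<sigma> H (f (Suc n)) = \<sigma> F (smul (\<kappa> + (-2) * of_nat n) (f n)) - smul 2 (f (Suc n))"
        using FH'[OF Suc(1)] Suc(2) by (simp only: f_Suc)
      also have "\<dots> = smul (\<kappa> + (-2) * of_nat n - 2) (f (Suc n))"
        by (simp only: act_scale_right[OF Suc(1)] M.scale_left_diff_distrib f_Suc)
      finally show ?case by (simp add: algebra_simps) }
  qed (use u in \<open>simp_all add: f_def\<close>)
  \<comment> \<open>Moving \<open>E\<close> past one \<open>F\<close> adds the current weight; the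
    weights \<open>\<kappa>\<close>, \<open>\<kappa> - 2\<close>, and so on sum up to this
    factor.\<close>
  have E_f: "\<sigma> E (f (Suc n)) = smul (of_nat (Suc n) * (\<kappa> - of_nat n)) (f n)" for n
  proof (induction n)
    case 0
    then show ?case using EF'[OF u(1)] u F.zero by (simp add: f_def)
  next
    case (Suc n)
    have "\<sigma> E (f (Suc (Suc n))) = \<sigma> F (\<sigma> E (f (Suc n))) + \<sigma> H (f (Suc n))"
      using EF'[OF f(1)] by (simp add: f_Suc)
    also have "\<dots> = smul (of_nat (Suc n) * (\<kappa> - of_nat n) + (\<kappa> + (-2) * of_nat (Suc n))) (f (Suc n))"
      unfolding Suc f(2) by (simp only: act_scale_right[OF f(1)] f_Suc M.scale_left_distrib)
    finally show ?case by (simp add: algebra_simps)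
  qed
  obtain n where n: "f n \<noteq> 0" "f (Suc n) = 0"
    using weights[of f \<kappa> "-2"] f u by (auto simp: f_def)
  have f_nz: "f k \<noteq> 0" if "k \<le> n" for k
    using that n(1)
  proof (induction rule: inc_induct)
    case (step k)
    then show ?case using F.zero f_Suc[of k] by auto
  qed
  \<comment> \<open>Raising the vanishing vector at \<open>Suc n\<close> back must give 0. Since
    \<open>Suc n\<close> is nonzero in characteristic 0, this pins down the highest weight.\<close>
  have "smul (of_nat (Suc n) * (\<kappa> - of_nat n)) (f n) = 0"
    using E_f[of n] n(2) E.zero by simp
  then have \<kappa>: "\<kappa> = of_nat n" using n(1) by (auto simp del: of_nat_Suc)
  have ind: "independent_family smul {..n} f"
    using f f_nz by (intro H.eigenvectors_independent[of _ "\<lambda>n. \<kappa> + (-2) * of_nat n"])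
      (auto simp: inj_on_def)

  \<comment> \<open>The string spans the whole module\<close>
  have "M.span (f ` {..n}) = U"
  proof -
    let ?W = "M.span (f ` {..n})"
    have W: "?W \<subseteq> U" using f(1) carrier_subspace by (intro M.span_minimal) auto
    have invar: "T w \<in> ?W"
      if "subspace_endo smul U T" "\<And>k. k \<le> n \<Longrightarrow> T (f k) \<in> ?W" and w: "w \<in> ?W" for T w
    proof -
      interpret T: subspace_endo smul U T by fact
      obtain c where "w = (\<Sum>k\<le>n. smul (c k) (f k))"
        using w M.range_family_sum_eq_span[of "{..n}" f] by auto
      then have "T w = (\<Sum>k\<le>n. smul (c k) (T (f k)))" using f(1) by (simp add: T.sum_scale)
      then show ?thesis using that(2) by (auto intro!: M.span_sum M.span_scale)
    qed
    \<comment> \<open>The bound is \<open>Suc n\<close> so that lowering the last vector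
      \<open>f n\<close> is covered as well.\<close>
    have mem: "f k \<in> ?W" if "k \<le> Suc n" for k
      using that n(2) by (cases "k = Suc n") (auto intro: M.span_base M.span_zero)
    have EFH: "\<sigma> E w \<in> ?W" "\<sigma> F w \<in> ?W" "\<sigma> H w \<in> ?W" if "w \<in> ?W" for w
    proof -
      show "\<sigma> F w \<in> ?W" by (rule invar[OF subspace_endo_act _ that]) (simp add: f_Suc mem)
      show "\<sigma> H w \<in> ?W"
        by (rule invar[OF subspace_endo_act _ that]) (simp only: f(2) M.span_scale mem le_SucI)
      show "\<sigma> E w \<in> ?W"
      proof (rule invar[OF subspace_endo_act _ that])
        fix k assume "k \<le> n"
        then show "\<sigma> E (f k) \<in> ?W"
        proof (cases k)
          case 0
          then show ?thesis using u by (simp add: f_def M.span_zero)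
        next
          case (Suc j)
          then show ?thesis using \<open>k \<le> n\<close> by (simp only: E_f M.span_scale mem)
        qed
      qed
    qed
    have "\<sigma> \<xi> w \<in> ?W" if w: "w \<in> ?W" for \<xi> w
    proof -
      obtain \<alpha> \<beta> \<gamma> where "\<xi> = sl2_scale \<alpha> E + sl2_scale \<beta> F + sl2_scale \<gamma> H" using span by blast
      then have "\<sigma> \<xi> w = smul \<alpha> (\<sigma> E w) + smul \<beta> (\<sigma> F w) + smul \<gamma> (\<sigma> H w)"
        using subsetD[OF W w] by (simp only: act_add_left act_scale_left)
      then show ?thesis by (simp only: M.span_add M.span_scale EFH[OF w])
    qed
    moreover have "?W \<noteq> {0}" using mem[of n] n(1) by auto
    ultimately show ?thesis using irr W unfolding irreducible_module_def by (meson M.subspace_span)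
  qed
  then have basis: "basis_family smul U {..n} f"
    using ind M.range_family_sum_eq_span[of "{..n}" f] by (simp add: basis_family_def)
  then have "n = d" using M.dim_basis_family dim by fastforce
  \<comment> \<open>The vector \<open>f k\<close> has weight \<open>d - 2 * k\<close>; reversal
    makes the weights increase from \<open>- d\<close>.\<close>
  have rev: "bij_betw (\<lambda>k. d - k) {..d} {..d}"
    by (rule bij_betw_byWitness[of _ "\<lambda>k. d - k"]) auto
  show ?thesis
  proof (rule that[of "\<lambda>k. f (d - k)"])
    show "basis_family smul U {..d} (\<lambda>k. f (d - k))"
      using M.basis_family_reindex[OF rev] basis \<open>n = d\<close> by (simp add: comp_def)
    fix k assume "k \<le> d"
    then show "\<sigma> (sl2_vec p q r) (f (d - k)) = smul (2 * of_nat k - of_nat d) (f (d - k))"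
      using f(2)[of "d - k"] by (simp add: H_def \<kappa> \<open>n = d\<close> of_nat_diff algebra_simps)
  qed
qed


section \<open>Bases of tensor products\<close>

lemma linear_free_extend:
  fixes smul :: "'a::field \<Rightarrow> 'v::ab_group_add \<Rightarrow> 'v"
    and \<tau> :: "'c \<Rightarrow> 'v"
  assumes "vector_space smul"
  shows "Vector_Spaces.linear free_scale smul (free_extend smul \<tau>)"
proof -
  interpret vector_space smul by fact
  interpret F: vector_space "free_scale :: 'a \<Rightarrow> ('c \<Rightarrow>\<^sub>0 'a) \<Rightarrow> _" by (rule vector_space_free_scale)
  \<comment> \<open>Any finite superset of the support may serve as index set, so two elements can
    be summed over a common one.\<close>
  have *: "free_extend smul \<tau> p = (\<Sum>b\<in>S. smul (Poly_Mapping.lookup p b) (\<tau> b))"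
    if "finite S" "Poly_Mapping.keys p \<subseteq> S" for p S
    unfolding free_extend_def
    by (rule sum.mono_neutral_left) (use that in \<open>auto simp: in_keys_iff\<close>)
  have "free_extend smul \<tau> (p + q) = free_extend smul \<tau> p + free_extend smul \<tau> q" for p q
    using keys_add[of p q]
    by (simp add: *[of "Poly_Mapping.keys p \<union> Poly_Mapping.keys q"] lookup_add
        scale_left_distrib sum.distrib)
  moreover have "free_extend smul \<tau> (free_scale c p) = smul c (free_extend smul \<tau> p)" for c p
  proof -
    have "Poly_Mapping.keys (free_scale c p) \<subseteq> Poly_Mapping.keys p"
      by (auto simp: in_keys_iff lookup_free_scale)
    then show ?thesis
      by (simp add: *[of "Poly_Mapping.keys p"] lookup_free_scale scale_sum_right)
  qed
  ultimately show ?thesis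
    by (simp add: Vector_Spaces.linear_iff vector_space_axioms F.vector_space_axioms)
qed

lemma free_extend_single:
  assumes "vector_space smul"
  shows "free_extend smul \<tau> (Poly_Mapping.single u c) = smul c (\<tau> u)"
proof -
  interpret vector_space smul by fact
  show ?thesis by (simp add: free_extend_def)
qed

text \<open>Every multilinearity relation lies in the kernel of the linear extension of
  \<open>\<tau>\<close>.\<close>

lemma
  fixes smul :: "'a::field \<Rightarrow> 'v::ab_group_add \<Rightarrow> 'v"
    and smulU :: "'a \<Rightarrow> 'u::ab_group_add \<Rightarrow> 'u"
    and I :: "'i set"
  assumes "vector_space smul" "is_tensor_product smulU I U smul V \<tau>"
    and "u \<in> PiE I U" "j \<in> I" "w \<in> U j"
  shows tensor_add: "w' \<in> U j \<Longrightarrow> \<tau> (u(j := w + w')) = \<tau> (u(j := w)) + \<tau> (u(j := w'))"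
    and tensor_scale: "\<tau> (u(j := smulU c w)) = smul c (\<tau> (u(j := w)))"
proof -
  interpret vector_space smul by fact
  interpret F: vector_space "free_scale :: 'a \<Rightarrow> (('i \<Rightarrow> 'u) \<Rightarrow>\<^sub>0 'a) \<Rightarrow> _"
    by (rule vector_space_free_scale)
  interpret L: Vector_Spaces.linear free_scale smul "free_extend smul \<tau>"
    by (rule linear_free_extend) fact
  have rel: "free_extend smul \<tau> p = 0" if "p \<in> tensor_rels smulU I U" for p
    using assms(2) F.span_base[OF that] unfolding is_tensor_product_def by blast
  note single = free_extend_single[OF assms(1)]
  show "\<tau> (u(j := w + w')) = \<tau> (u(j := w)) + \<tau> (u(j := w'))" if "w' \<in> U j"
  proof -
    have "free_extend smul \<tau> (Poly_Mapping.single (u(j := w + w')) 1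
        - Poly_Mapping.single (u(j := w)) 1 - Poly_Mapping.single (u(j := w')) 1) = 0"
      using assms that by (intro rel) (unfold tensor_rels_def, blast)
    then show ?thesis by (simp add: L.diff L.add single diff_diff_eq)
  qed
  have "free_extend smul \<tau> (Poly_Mapping.single (u(j := smulU c w)) 1
      - free_scale c (Poly_Mapping.single (u(j := w)) 1)) = 0"
    using assms by (intro rel) (unfold tensor_rels_def, blast)
  then show "\<tau> (u(j := smulU c w)) = smul c (\<tau> (u(j := w)))"
    by (simp add: L.diff L.scale single)
qed

text \<open>Independence uses that the kernel contains nothing beyond the span of the relations;
  spanning uses multilinearity, one slot at a time. The assumption on \<open>smulU\<close> is stated
  per slot because, with no slots, the modules say nothing about \<open>smulU\<close>.\<close>

lemma tensor_basis_family:
  fixes smul :: "'a::field \<Rightarrow> 'v::ab_group_add \<Rightarrow> 'v"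
    and smulU :: "'a \<Rightarrow> 'u::ab_group_add \<Rightarrow> 'u"
    and I :: "'i set" and M :: "'i \<Rightarrow> 'k set"
  assumes vs: "vector_space smul" and "finite I" and tp: "is_tensor_product smulU I U smul V \<tau>"
    and vsU: "\<And>j. j \<in> I \<Longrightarrow> vector_space smulU"
    and b: "\<And>j. j \<in> I \<Longrightarrow> basis_family smulU (U j) (M j) (b j)"
  shows "basis_family smul V (PiE I M) (\<lambda>m. \<tau> (\<lambda>j\<in>I. b j (m j)))"
proof -
  interpret vector_space smul by fact
  interpret F: vector_space "free_scale :: 'a \<Rightarrow> (('i \<Rightarrow> 'u) \<Rightarrow>\<^sub>0 'a) \<Rightarrow> _"
    by (rule vector_space_free_scale)
  interpret L: Vector_Spaces.linear free_scale smul "free_extend smul \<tau>"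
    by (rule linear_free_extend) fact
  define bt where "bt m = (\<lambda>j\<in>I. b j (m j))" for m
  have bU: "b j k \<in> U j" if "j \<in> I" "k \<in> M j" for j k
    using vector_space.basis_family_mem[OF vsU b] that by blast
  have btU: "bt m \<in> PiE I U" if "m \<in> PiE I M" for m
    using that by (auto simp: bt_def intro!: bU)
  have fin: "finite (PiE I M)"
    using \<open>finite I\<close> b by (intro finite_PiE) (auto simp: basis_family_def independent_family_def)
  \<comment> \<open>A lift of the combination with coefficients \<open>c\<close> to the free
    space.\<close>
  define P where "P c = (\<Sum>m\<in>PiE I M. free_scale (c m) (Poly_Mapping.single (bt m) 1))" for c :: "_ \<Rightarrow> 'a"
  have FE_P: "free_extend smul \<tau> (P c) = (\<Sum>m\<in>PiE I M. smul (c m) (\<tau> (bt m)))" for c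
    by (simp add: P_def L.sum L.scale free_extend_single[OF vs])
  have keys_P: "Poly_Mapping.keys (P c) \<subseteq> PiE I U" for c
  proof -
    have "Poly_Mapping.keys (P c) \<subseteq>
        (\<Union>m\<in>PiE I M. Poly_Mapping.keys (free_scale (c m) (Poly_Mapping.single (bt m) 1)))"
      unfolding P_def by (rule keys_sum)
    moreover have "Poly_Mapping.keys (free_scale (c m) (Poly_Mapping.single (bt m) 1)) \<subseteq> {bt m}" for m
      by (auto simp: in_keys_iff lookup_free_scale lookup_single when_def split: if_splits)
    ultimately show ?thesis using btU by blast
  qed

  \<comment> \<open>Independence of the tensors of basis vectors\<close>
  have ind: "independent_family smul (PiE I M) (\<lambda>m. \<tau> (bt m))"
    unfolding independent_family_def
  proof (intro conjI allI impI ballI fin)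
    fix c m0 assume c: "(\<Sum>m\<in>PiE I M. smul (c m) (\<tau> (bt m))) = 0" and m0: "m0 \<in> PiE I M"
    define Q where "Q j coord \<longleftrightarrow>
      (\<forall>v\<in>U j. \<forall>w\<in>U j. \<forall>k\<in>M j. coord (v + w) k = coord v k + coord w k) \<and>
      (\<forall>c. \<forall>v\<in>U j. \<forall>k\<in>M j. coord (smulU c v) k = c * coord v k) \<and>
      (\<forall>l\<in>M j. \<forall>k\<in>M j. coord (b j l) k = (if k = l then 1 else 0))"
      for j and coord :: "'u \<Rightarrow> 'k \<Rightarrow> 'a"
    have "\<exists>coord. \<forall>j\<in>I. Q j (coord j)"
      unfolding Q_def by (intro bchoice ballI vector_space.basis_family_coordinates vsU b)
    then obtain coord where Q: "\<forall>j\<in>I. Q j (coord j)" ..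
    then have coord: "v \<in> U j \<Longrightarrow> w \<in> U j \<Longrightarrow> coord j (v + w) k = coord j v k + coord j w k"
      "v \<in> U j \<Longrightarrow> coord j (smulU c v) k = c * coord j v k"
      "l \<in> M j \<Longrightarrow> coord j (b j l) k = (if k = l then 1 else 0)"
      if "j \<in> I" "k \<in> M j" for j v w k c l
      using that unfolding Q_def by blast+
    \<comment> \<open>the coordinate of a pure tensor at \<open>m0\<close>; being multilinear, it kills the relations\<close>
    define \<phi> where "\<phi> u = (\<Prod>j\<in>I. coord j (u j) (m0 j))" for u
    have vsA: "vector_space ((*) :: 'a \<Rightarrow> 'a \<Rightarrow> 'a)"
      by unfold_locales (simp_all add: algebra_simps)
    interpret K: Vector_Spaces.linear free_scale "(*)" "free_extend (*) \<phi>"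
      by (rule linear_free_extend) (rule vsA)
    note single = free_extend_single[OF vsA]
    \<comment> \<open>Isolating the factor at \<open>j\<close> exhibits linearity in that
      slot.\<close>
    have upd: "\<phi> (u(j := w)) = coord j w (m0 j) * (\<Prod>k\<in>I - {j}. coord k (u k) (m0 k))"
      if "j \<in> I" for u j w
      using that \<open>finite I\<close> by (auto simp: \<phi>_def prod.remove intro!: prod.cong)
    have "free_extend (*) \<phi> p = 0" if "p \<in> tensor_rels smulU I U" for p
      using that m0 unfolding tensor_rels_def
      by (auto simp: K.diff K.scale single upd coord PiE_mem distrib_right mult.assoc)
    then have "F.span (tensor_rels smulU I U) \<subseteq> {p. free_extend (*) \<phi> p = 0}"
      by (intro F.span_minimal K.subspace_kernel) auto
    \<comment> \<open>This is where exactness enters: an element of the free space over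
      \<open>PiE I U\<close> that maps to 0 is a combination of relations.\<close>
    moreover have "P c \<in> F.span (tensor_rels smulU I U)"
      using tp keys_P[of c] FE_P[of c] c unfolding is_tensor_product_def by auto
    ultimately have "0 = free_extend (*) \<phi> (P c)" by auto
    also have "\<dots> = (\<Sum>m\<in>PiE I M. c m * \<phi> (bt m))"
      by (simp add: P_def K.sum K.scale single)
    also have "\<dots> = (\<Sum>m\<in>PiE I M. if m = m0 then c m else 0)"
    proof (rule sum.cong[OF HOL.refl])
      fix m assume m: "m \<in> PiE I M"
      have "\<phi> (bt m) = (\<Prod>j\<in>I. if m0 j = m j then 1 else 0)"
        unfolding \<phi>_def bt_def using m m0 by (intro prod.cong) (auto simp: coord PiE_mem)
      also have "\<dots> = (if m = m0 then 1 else 0)"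
      proof (cases "m = m0")
        case False
        then obtain j where "j \<in> I" "m0 j \<noteq> m j" using PiE_ext[OF m m0] by metis
        then show ?thesis using False \<open>finite I\<close> by (auto intro!: prod_zero)
      qed simp
      finally show "c m * \<phi> (bt m) = (if m = m0 then c m else 0)" by simp
    qed
    also have "\<dots> = c m0" using fin m0 by simp
    finally show "c m0 = 0" ..
  qed

  \<comment> \<open>Spanning by the tensors of basis vectors\<close>
  define W where "W = span ((\<lambda>m. \<tau> (bt m)) ` PiE I M)"
  \<comment> \<open>induction on the set \<open>J\<close> of slots not yet filled with basis vectors\<close>
  have tau_W: "\<tau> u \<in> W"
    if "finite J" "J \<subseteq> I" "u \<in> PiE I U" "\<And>j. j \<in> I - J \<Longrightarrow> u j \<in> b j ` M j" for J u
    using that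
  proof (induction J arbitrary: u)
    case empty
    then have "\<forall>j\<in>I. \<exists>k. k \<in> M j \<and> u j = b j k" by blast
    then obtain m where m: "\<And>j. j \<in> I \<Longrightarrow> m j \<in> M j \<and> u j = b j (m j)" by metis
    then have "u = bt (restrict m I)" using empty by (auto simp: bt_def fun_eq_iff PiE_def extensional_def)
    moreover have "restrict m I \<in> PiE I M" using m by auto
    ultimately show ?case unfolding W_def by (auto intro: span_base)
  next
    case (insert x J)
    then have x: "x \<in> I" by simp
    interpret U: vector_space smulU using vsU[OF x] .
    have Ux: "U x = U.span (b x ` M x)"
      using b[OF x] U.range_family_sum_eq_span[of "M x" "b x"]
      by (simp add: basis_family_def independent_family_def)
    \<comment> \<open>Membership in \<open>U x\<close> is carried along because additivity of
      \<open>\<tau>\<close> in the slot requires it of the tail of the combination.\<close>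
    have slot: "w \<in> U x \<and> \<tau> (u(x := w)) \<in> W" if "w \<in> U.span (b x ` M x)" for w
      using that
    proof (induction rule: U.span_induct_alt)
      case base
      \<comment> \<open>Writing the zero vector as a multiple by 0 lets \<open>tensor_scale\<close>
        produce the zero tensor.\<close>
      have "\<tau> (u(x := smulU 0 0)) = 0"
        using tensor_scale[where c = 0, OF vs tp insert.prems(2) x, of 0] by (simp add: Ux U.span_zero)
      then show ?case by (simp only: U.scale_zero_left W_def span_zero Ux U.span_zero simp_thms)
    next
      case (step c y z)
      have y: "y \<in> U x" and z: "z \<in> U x" using step Ux by (simp_all add: U.span_base)
      have "\<tau> (u(x := y)) \<in> W"
        using insert.prems step(1) x y by (intro insert.IH) (auto simp: PiE_iff extensional_def)
      moreover have "\<tau> (u(x := smulU c y + z)) = smul c (\<tau> (u(x := y))) + \<tau> (u(x := z))"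
        using y z Ux tensor_add[OF vs tp insert.prems(2) x _ z, of "smulU c y"]
          tensor_scale[OF vs tp insert.prems(2) x y] by (simp add: U.span_scale)
      ultimately have "\<tau> (u(x := smulU c y + z)) \<in> W"
        using step(2) unfolding W_def by (simp only: span_add span_scale)
      moreover have "smulU c y + z \<in> U x" using y z Ux by (simp add: U.span_add U.span_scale)
      ultimately show ?case by blast
    qed
    show ?case using slot[of "u x"] PiE_mem[OF insert.prems(2) x] Ux by simp
  qed
  have "V = range (\<lambda>c. \<Sum>m\<in>PiE I M. smul (c m) (\<tau> (bt m)))"
  proof (intro antisym subsetI)
    fix v assume "v \<in> V"
    then obtain p where p: "Poly_Mapping.keys p \<subseteq> PiE I U" "v = free_extend smul \<tau> p"
      using tp unfolding is_tensor_product_def by blast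
    have "v \<in> W"
      unfolding p(2) free_extend_def W_def
      using p(1) tau_W[OF \<open>finite I\<close>] by (intro span_sum span_scale) (auto simp: W_def)
    then show "v \<in> range (\<lambda>c. \<Sum>m\<in>PiE I M. smul (c m) (\<tau> (bt m)))"
      by (simp add: W_def range_family_sum_eq_span[OF fin])
  next
    fix v assume "v \<in> range (\<lambda>c. \<Sum>m\<in>PiE I M. smul (c m) (\<tau> (bt m)))"
    then obtain c where "v = free_extend smul \<tau> (P c)" by (auto simp: FE_P)
    then show "v \<in> V" using tp keys_P unfolding is_tensor_product_def by blast
  qed
  then show ?thesis using ind by (simp add: basis_family_def bt_def)
qed

text \<open>By \<open>EV_gen_norm\<close> every generator has an image whose square is 1, so the
  spectrum depends neither on the pair \<open>i\<close>, \<open>j\<close> nor on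
  \<open>a\<close>.\<close>

lemma evaluation_module_eigenbasis:
  fixes smulU :: "'a::{alg_closed_field, field_char_0} \<Rightarrow> 'u::ab_group_add \<Rightarrow> 'u"
  assumes "evaluation_module d a smulU U actU" "i \<noteq> j"
  obtains b where "basis_family smulU U {..d} b"
    "\<And>k. k \<le> d \<Longrightarrow> actU (tetra_x i j) (b k) = smulU (2 * of_nat k - of_nat d) (b k)"
proof -
  obtain \<sigma> where a: "a \<noteq> 0" "a \<noteq> 1"
    and \<sigma>: "lie_module sl2_scale sl2_bracket smulU U \<sigma>" "irreducible_module smulU U \<sigma>"
      "vector_space.dim smulU U = d + 1" "\<And>\<xi> u. u \<in> U \<Longrightarrow> actU \<xi> u = \<sigma> (EV a \<xi>) u"
    using assms(1) unfolding evaluation_module_def by blast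
  interpret lie_module sl2_scale sl2_bracket smulU U \<sigma> by fact
  obtain p q r where pqr: "EV_gen a i j = sl2_vec p q r" using sl2_vec_exhaust by blast
  then have norm: "r * r + p * q = 1" using EV_gen_norm[OF a assms(2)] by blast
  have EV: "EV a (tetra_x i j) = sl2_vec p q r"
    using is_EV_EV[OF a] assms(2) pqr unfolding is_EV_iff by simp
  obtain b where "basis_family smulU U {..d} b"
    "\<And>k. k \<le> d \<Longrightarrow> \<sigma> (sl2_vec p q r) (b k) = smulU (2 * of_nat k - of_nat d) (b k)"
    using sl2_irreducible_eigenbasis[OF \<sigma>(1-3) norm] by metis
  then show ?thesis using M.basis_family_mem[of U "{..d}" b] \<sigma>(4) EV by (intro that[of b]) auto
qed

text \<open>The algebra acts on pure tensors by the Leibniz rule, so a tensor of eigenvectors is an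
  eigenvector and its eigenvalue is the sum of those of the factors.\<close>

lemma tensor_module_eigenbasis:
  fixes smul :: "'a::{alg_closed_field, field_char_0} \<Rightarrow> 'v::ab_group_add \<Rightarrow> 'v"
    and smulU :: "'a \<Rightarrow> 'u::ab_group_add \<Rightarrow> 'u"
  assumes "vector_space smul" "finite I"
    and ev: "\<And>k. k \<in> I \<Longrightarrow> evaluation_module (d k) (a k) smulU (U k) (actU k)"
    and "is_tensor_module smulU I U actU smul V act"
    and "i \<noteq> j"
  obtains f where "basis_family smul V (PiE I (\<lambda>k. {..d k})) f"
    "\<And>m. m \<in> PiE I (\<lambda>k. {..d k}) \<Longrightarrow> act (tetra_x i j) (f m) =
      smul (2 * of_nat (\<Sum>k\<in>I. m k) - of_nat (\<Sum>k\<in>I. d k)) (f m)"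
proof -
  interpret vector_space smul by fact
  let ?x = "tetra_x i j :: 'a tetra"
  let ?M = "PiE I (\<lambda>k. {..d k})"
  obtain \<tau> where \<tau>: "is_tensor_product smulU I U smul V \<tau>"
    "\<And>\<xi> u. u \<in> PiE I U \<Longrightarrow> act \<xi> (\<tau> u) = (\<Sum>k\<in>I. \<tau> (u(k := actU k \<xi> (u k))))"
    using assms(4) unfolding is_tensor_module_def by blast
  have vsU: "vector_space smulU" if "k \<in> I" for k
    using ev[OF that] unfolding evaluation_module_def lie_module_def by blast
  have "\<exists>b. basis_family smulU (U k) {..d k} b \<and>
      (\<forall>n\<le>d k. actU k ?x (b n) = smulU (2 * of_nat n - of_nat (d k)) (b n))" if "k \<in> I" for k
    using evaluation_module_eigenbasis[OF ev[OF that] assms(5)] by metis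
  then obtain b where b: "\<And>k. k \<in> I \<Longrightarrow> basis_family smulU (U k) {..d k} (b k)"
    "\<And>k n. k \<in> I \<Longrightarrow> n \<le> d k \<Longrightarrow> actU k ?x (b k n) = smulU (2 * of_nat n - of_nat (d k)) (b k n)"
    by metis
  show ?thesis
  proof (rule that)
    show "basis_family smul V ?M (\<lambda>m. \<tau> (\<lambda>k\<in>I. b k (m k)))"
      by (rule tensor_basis_family[OF assms(1,2) \<tau>(1) vsU b(1)])
    fix m assume m: "m \<in> ?M"
    define u where "u = (\<lambda>k\<in>I. b k (m k))"
    have bU: "b k (m k) \<in> U k" if "k \<in> I" for k
      using vector_space.basis_family_mem[OF vsU b(1)] that m by (auto simp: PiE_iff)
    then have u: "u \<in> PiE I U" by (auto simp: u_def)
    have "act ?x (\<tau> u) = (\<Sum>k\<in>I. \<tau> (u(k := actU k ?x (u k))))" by (rule \<tau>(2)[OF u])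
    also have "\<dots> = (\<Sum>k\<in>I. smul (2 * of_nat (m k) - of_nat (d k)) (\<tau> u))"
    proof (rule sum.cong[OF HOL.refl])
      fix k assume k: "k \<in> I"
      then have "actU k ?x (u k) = smulU (2 * of_nat (m k) - of_nat (d k)) (u k)"
        using b(2)[OF k] m by (simp add: u_def PiE_iff)
      then show "\<tau> (u(k := actU k ?x (u k))) = smul (2 * of_nat (m k) - of_nat (d k)) (\<tau> u)"
        using tensor_scale[OF assms(1) \<tau>(1) u k, of "u k"] u k by (simp add: PiE_mem)
    qed
    also have "\<dots> = smul (2 * of_nat (\<Sum>k\<in>I. m k) - of_nat (\<Sum>k\<in>I. d k)) (\<tau> u)"
      by (simp add: scale_sum_left[symmetric] sum_subtractf sum_distrib_left)
    finally show "act ?x (\<tau> (\<lambda>k\<in>I. b k (m k))) =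
        smul (2 * of_nat (\<Sum>k\<in>I. m k) - of_nat (\<Sum>k\<in>I. d k)) (\<tau> (\<lambda>k\<in>I. b k (m k)))"
      by (simp only: u_def)
  qed
qed


section \<open>Counting weights\<close>

text \<open>To reach a total \<open>s\<close>, the new slot takes as much as it can,
  \<open>min s (d x)\<close>; the remainder fits into the other slots by induction.\<close>

lemma sum_PiE_atMost_image:
  assumes "finite I"
  shows "(\<lambda>m. \<Sum>k\<in>I. m k) ` PiE I (\<lambda>k. {..d k}) = {..\<Sum>k\<in>I. d k :: nat}"
  using assms
proof (induction I)
  case (insert x I)
  have "s \<in> (\<lambda>m. \<Sum>k\<in>insert x I. m k) ` PiE (insert x I) (\<lambda>k. {..d k})"
    if s: "s \<le> (\<Sum>k\<in>insert x I. d k)" for s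
  proof -
    have "s - min s (d x) \<in> {..\<Sum>k\<in>I. d k}" using s insert.hyps by auto
    then obtain m where m: "m \<in> PiE I (\<lambda>k. {..d k})" "(\<Sum>k\<in>I. m k) = s - min s (d x)"
      unfolding insert.IH[symmetric] by auto
    have "(\<Sum>k\<in>I. (m(x := min s (d x))) k) = (\<Sum>k\<in>I. m k)"
      using insert.hyps by (intro sum.cong) auto
    then have "(\<Sum>k\<in>insert x I. (m(x := min s (d x))) k) = s"
      using insert.hyps m(2) by simp
    moreover have "m(x := min s (d x)) \<in> PiE (insert x I) (\<lambda>k. {..d k})"
      using m(1) by (auto simp: PiE_iff extensional_def)
    ultimately show ?thesis by (metis (no_types, lifting) image_eqI)
  qed
  then show ?case by (auto intro!: sum_mono)
qed auto

text \<open>Expanding the product selects one exponent \<open>m k\<close> from each factor; the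
  resulting monomials are then grouped by total exponent.\<close>

lemma prod_geometric_monom:
  assumes "finite I"
  shows "(\<Prod>k\<in>I. \<Sum>n=0..d k. monom 1 n) =
    (\<Sum>n=0..\<Sum>k\<in>I. d k. monom (card {m \<in> PiE I (\<lambda>k. {..d k}). (\<Sum>k\<in>I. m k) = n}) n)"
proof -
  let ?M = "PiE I (\<lambda>k. {..d k})"
  have fin: "finite ?M" using assms by (intro finite_PiE) auto
  have prod_monom: "(\<Prod>k\<in>I. monom 1 (m k)) = monom (1::nat) (\<Sum>k\<in>I. m k)" for m
    using assms by (induction I) (simp_all add: mult_monom monom_0 one_pCons)
  have "(\<Prod>k\<in>I. \<Sum>n=0..d k. monom (1::nat) n) = (\<Sum>m\<in>?M. \<Prod>k\<in>I. monom 1 (m k))"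
    unfolding atLeast0AtMost using assms by (intro prod_sum_PiE) auto
  also have "\<dots> = (\<Sum>m\<in>?M. monom 1 (\<Sum>k\<in>I. m k))" by (simp only: prod_monom)
  also have "\<dots> = (\<Sum>n\<in>{..\<Sum>k\<in>I. d k}. \<Sum>m\<in>{m \<in> ?M. (\<Sum>k\<in>I. m k) = n}. monom 1 (\<Sum>k\<in>I. m k))"
    by (rule sum.group[symmetric]) (use fin sum_PiE_atMost_image[OF assms, of d] in auto)
  also have "\<dots> = (\<Sum>n\<in>{..\<Sum>k\<in>I. d k}. monom (card {m \<in> ?M. (\<Sum>k\<in>I. m k) = n}) n)"
    by (rule sum.cong) (simp_all add: of_nat_monom mult_monom)
  finally show ?thesis by (simp add: atLeast0AtMost)
qed

section \<open>Diameter and shape from the weight count\<close>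

theorem theorem16p5:
  fixes smul :: "'a::{alg_closed_field, field_char_0} \<Rightarrow> 'v::ab_group_add \<Rightarrow> 'v"
    and V :: "'v set"
    and act :: "'a tetra \<Rightarrow> 'v \<Rightarrow> 'v"
    and smulU :: "'a \<Rightarrow> 'u::ab_group_add \<Rightarrow> 'u"
    and U :: "nat \<Rightarrow> 'u set"
    and actU :: "nat \<Rightarrow> 'a tetra \<Rightarrow> 'u \<Rightarrow> 'u"
    and N :: nat
    and d :: "nat \<Rightarrow> nat"
    and a :: "nat \<Rightarrow> 'a"
  assumes "lie_module tetra_scale tetra_bracket smul V act"
    and "finite_dim_space smul V"
    and "irreducible_module smul V act"
    and "\<not> trivial_module smul V act"
    and "\<And>j. j \<in> {1..N} \<Longrightarrow> evaluation_module (d j) (a j) smulU (U j) (actU j)"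
    and "is_tensor_module smulU {1..N} U actU smul V act"
  shows "(\<Sum>n = 0..module_diameter smul V act. monom (module_shape smul V act n) n) =
           (\<Prod>j = 1..N. \<Sum>k = 0..d j. monom 1 k) \<and>
         module_shape smul V act 0 = 1"
proof -
  interpret lie_module tetra_scale tetra_bracket smul V act by fact
  let ?I = "{1..N}"
  let ?M = "PiE ?I (\<lambda>k. {..d k})"
  let ?C = "\<lambda>n. {m \<in> ?M. (\<Sum>k\<in>?I. m k) = n}"
  define D where "D = (\<Sum>k\<in>?I. d k)"
  define \<mu> where "\<mu> m = (2 * of_nat (\<Sum>k\<in>?I. m k) - of_nat D :: 'a)" for m
  \<comment> \<open>In characteristic 0 the factor 2 cancels and \<open>of_nat\<close> is injective,
    so an eigenvalue determines the total of \<open>m\<close>.\<close>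
  have \<mu>_eq: "\<mu> m = 2 * of_nat n - of_nat D \<longleftrightarrow> (\<Sum>k\<in>?I. m k) = n" for m n
    by (simp add: \<mu>_def del: of_nat_sum)
  \<comment> \<open>The eigenbasis varies with the pair, but its index set and eigenvalues do not;
    hence a common diameter and shape exist.\<close>
  have main: "eigenvalues smul V (act (tetra_x i j)) = \<mu> ` ?M"
    "M.dim (eigenspace smul V (act (tetra_x i j)) c) = card {m \<in> ?M. \<mu> m = c}"
    if "i \<noteq> j" for i j :: idx and c
  proof -
    obtain f where f: "basis_family smul V ?M f"
      "\<And>m. m \<in> ?M \<Longrightarrow> act (tetra_x i j) (f m) = smul (\<mu> m) (f m)"
      using tensor_module_eigenbasis[OF M.vector_space_axioms _ assms(5,6) \<open>i \<noteq> j\<close>]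
        finite_atLeastAtMost unfolding \<mu>_def D_def by metis
    interpret subspace_endo smul V "act (tetra_x i j)" by (rule subspace_endo_act)
    show "eigenvalues smul V (act (tetra_x i j)) = \<mu> ` ?M"
      "M.dim (eigenspace smul V (act (tetra_x i j)) c) = card {m \<in> ?M. \<mu> m = c}"
      using eigenvalues_eigenbasis[OF f] dim_eigenspace_eigenbasis[OF f] by auto
  qed
  have "\<mu> ` ?M = (\<lambda>s. 2 * of_nat s - of_nat D) ` (\<lambda>m. \<Sum>k\<in>?I. m k) ` ?M"
    by (simp add: \<mu>_def image_comp comp_def)
  also have "\<dots> = (\<lambda>s. 2 * of_nat s - of_nat D) ` {..D}"
    unfolding D_def by (subst sum_PiE_atMost_image) simp_all
  \<comment> \<open>The same values are listed in opposite order, with \<open>D - s\<close>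
    translating between the two.\<close>
  also have "\<dots> = {of_nat D - 2 * of_nat n |n. n \<le> D}"
  proof (intro antisym subsetI)
    fix c :: 'a assume "c \<in> (\<lambda>s. 2 * of_nat s - of_nat D) ` {..D}"
    then obtain s where "s \<le> D" "c = 2 * of_nat s - of_nat D" by auto
    then show "c \<in> {of_nat D - 2 * of_nat n |n. n \<le> D}"
      by (intro CollectI exI[of _ "D - s"]) (simp add: of_nat_diff)
  next
    fix c :: 'a assume "c \<in> {of_nat D - 2 * of_nat n |n. n \<le> D}"
    then obtain n where "n \<le> D" "c = of_nat D - 2 * of_nat n" by auto
    then show "c \<in> (\<lambda>s. 2 * of_nat s - of_nat D) ` {..D}"
      by (intro image_eqI[of _ _ "D - n"]) (simp_all add: of_nat_diff)
  qed
  finally have spectrum: "\<mu> ` ?M = {of_nat D - 2 * of_nat n |n. n \<le> D}" .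
  have diam: "module_diameter smul V act = D"
    unfolding module_diameter_def
  proof (rule the_equality)
    show "\<forall>i j. i \<noteq> j \<longrightarrow>
        eigenvalues smul V (act (tetra_x i j)) = {of_nat D - 2 * of_nat n |n. n \<le> D}"
      using main(1) spectrum by simp
    fix D' assume *: "\<forall>i j. i \<noteq> j \<longrightarrow>
        eigenvalues smul V (act (tetra_x i j)) = {of_nat D' - 2 * of_nat n |n. n \<le> D'}"
    have eq: "{of_nat D' - 2 * of_nat n |n. n \<le> D'} = {of_nat D - 2 * of_nat n :: 'a |n. n \<le> D}"
      using *[rule_format, of I0 I1] main(1)[of I0 I1] spectrum by simp
    \<comment> \<open>The largest eigenvalue determines the diameter: by characteristic 0,
      \<open>E + 2 * n = E'\<close> already holds for the natural numbers.\<close>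
    have le: "E \<le> E'" if E: "(of_nat E :: 'a) \<in> {of_nat E' - 2 * of_nat n |n. n \<le> E'}" for E E'
    proof -
      obtain n where "(of_nat E :: 'a) = of_nat E' - 2 * of_nat n" using E by blast
      then have "(of_nat (E + 2 * n) :: 'a) = of_nat E'" by simp
      then show ?thesis unfolding of_nat_eq_iff by simp
    qed
    have "(of_nat E :: 'a) \<in> {of_nat E - 2 * of_nat n |n. n \<le> E}" for E
      by (intro CollectI exI[of _ 0]) simp
    then show "D' = D" using le[of D D'] le[of D' D] eq by (intro antisym) blast+
  qed
  have shape: "module_shape smul V act n = card (?C n)" for n
    unfolding module_shape_def diam
  proof (rule the_equality)
    show "\<forall>i j. i \<noteq> j \<longrightarrow> M.dim (eigenspace smul V (act (tetra_x i j))
        (2 * of_nat n - of_nat D)) = card (?C n)"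
      by (simp add: main(2) \<mu>_eq)
    fix r assume "\<forall>i j. i \<noteq> j \<longrightarrow> M.dim (eigenspace smul V (act (tetra_x i j))
        (2 * of_nat n - of_nat D)) = r"
    \<comment> \<open>One pair of distinct indices suffices to determine \<open>r\<close>.\<close>
    then have "r = M.dim (eigenspace smul V (act (tetra_x I0 I1)) (2 * of_nat n - of_nat D))"
      by (metis idx.distinct(1))
    also have "\<dots> = card (?C n)" by (simp add: main(2) \<mu>_eq)
    finally show "r = card (?C n)" .
  qed
  \<comment> \<open>A sum of natural numbers vanishes only if all terms do; the zero family is
    restricted to \<open>?I\<close> because members of \<open>PiE\<close> are
    \<open>undefined\<close> elsewhere.\<close>
  have "?C 0 = {\<lambda>k\<in>?I. 0}" by (auto simp: PiE_iff extensional_def fun_eq_iff)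
  then have "card (?C 0) = 1" by simp
  then show ?thesis
    unfolding diam shape D_def prod_geometric_monom[OF finite_atLeastAtMost] by simp
qed

end
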